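(* Assume the game and the gradient noise satisfy the standing assumptions (i)–(vi) given in the context, with moment exponent $\delta\in(1,2]$. Consider the median-of-means algorithm with online bias correction described in the context, with step sizes $\alpha_k=b(k+1)^{-a}$ for some $a\in(0,1]$ and $b>0$, and sample sizes $m_k=c\lceil(k+1)^\beta\rceil$ for some $\beta>\frac{1}{\delta-1}$ and integer $c\ge1$. Let the block parameters be $$b_k=\Big\lfloor \min\big\{8\ln(e^{1/8}\gamma_k^{-1}),\ \tfrac{m_k}{2}\big\}\Big\rfloor,\qquad s_k=\Big\lfloor \frac{m_k}{b_k}\Big\rfloor,\qquad \gamma_k=\frac{1}{(k+1)^2},$$ and let the decay coefficient be $\eta_k=\eta_0(k+1)^{-\rho}$ with $\eta_0>0$, $\rho>0$, where $\eta_k\in[0,1]$ for all $k$. Then the sequence $\{\mathbf{x}_k\}$ generated by the algorithm converges almost surely to the unique Nash equilibrium $x^*$, i.e. $\lim_{k\to\infty}\|\mathbf{x}_k-x^*\|=0$ almost surely.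
   Context: **Game.** There are $N>1$ players. Player $i\in\{1,\dots,N\}$ chooses $x_i\in\Omega_i\subseteq\mathbb{R}$ to minimize $J_i(x_i,x_{-i}):=\mathbb{E}_{\xi_i}[f_i(x_i,x_{-i},\xi_i)]$, where $x_{-i}\in\Omega_{-i}:=\prod_{j\ne i}\Omega_j$ is the vector of the other players' actions and $\xi_i$ is a real random variable. Write $J_i(x)=J_i(x_i,x_{-i})$ and $\Omega=\Omega_1\times\cdots\times\Omega_N$; $f_i$ and $J_i$ are defined on an open set containing $\Omega$ in the variable $x$, so that the derivatives below make sense on $\Omega$. A Nash equilibrium is $x^*\in\Omega$ with $J_i(x_i^*,x_{-i}^* )\le J_i(x_i,x_{-i}^* )$ for all $x_i\in\Omega_i$ and all $i$. $\|\cdot\|$ is the Euclidean norm and $\mathbb{P}_{\Omega_i}[\cdot]$ is Euclidean projection onto $\Omega_i$. The pseudo-gradient is $F(x):=[\nabla_{x_1}J_1(x),\dots,\nabla_{x_N}J_N(x)]^\top\in\mathbb{R}^N$. **Algorithm with online bias correction.** Start from $\mathbf{x}_0\in\Omega$. At step $k=0,1,2,\dots$, with $\mathbf{x}_k=[x_{1,k},\dots,x_{N,k}]^\top$, each player $i$: (1) draws $m_k$ i.i.d. samples $\xi_{i,k}^1,\dots,\xi_{i,k}^{m_k}$ of $\xi_i$, independent of the past, and computes $g_{i,k}^j=\nabla_{x_i}f_i(\mathbf{x}_k,\xi_{i,k}^j)$; (2) forms $b_k$ disjoint blocks $B_1,\dots,B_{b_k}$ of sample indices, each of size $s_k$ (leftover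 samples are unused), and computes $\bar g_{i,k}^\ell=\frac1{s_k}\sum_{j\in B_\ell}g_{i,k}^j$; (3) computes $\hat g_{i,k}=\operatorname{median}\{\bar g_{i,k}^1,\dots,\bar g_{i,k}^{b_k}\}$ (the average of the two middle values if $b_k$ is even); (4) computes $\bar g_{i,k}=\frac1{b_k}\sum_{\ell=1}^{b_k}\bar g_{i,k}^\ell$ and the corrected estimate $\tilde g_{i,k}=(1-\eta_k)\hat g_{i,k}+\eta_k\bar g_{i,k}$, where $\eta_k\in[0,1]$; (5) sets $x_{i,k+1}=\mathbb{P}_{\Omega_i}[x_{i,k}-\alpha_k\tilde g_{i,k}]$. If the formula for $b_k$ gives $0$ (which happens only when $m_k=1$, i.e. $k=0$, $c=1$), take $b_k=s_k=1$. **Standing assumptions.** Let $\mathcal{F}_k$ be the $\sigma$-algebra containing all randomness up to step $k-1$ (so $\mathbf{x}_k$ is $\mathcal{F}_k$-measurable), and let $\epsilon_{i,k}^j=g_{i,k}^j-\nabla_{x_i}J_i(\mathbf{x}_k)$. (i) $\Omega$ is nonempty, convex and compact. (ii) Each $J_i$ is continuously differentiable, and convex in $x_i$ for every fixed $x_{-i}\in\Omega_{-i}$. (iii) $F$ is strongly monotone with modulus $\mu>0$: $(F(x)-F(y))^\top(x-y)\ge\mu\|x-y\|^2$ for all $x,y\in\Omega$. (iv) $F$ is $L$-Lipschitz for some $L>0$: $\|F(x)-F(y)\|\le L\|x-y\|$ for all $x,y\in\Omega$. (v) For all $i$, $k\ge0$, $j$: $\mathbb{E}[\epsilon_{i,k}^j\mid\mathcal{F}_k]=0$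 a.s. (vi) There exist $1<\delta\le2$ and $\nu>0$ with $\mathbb{E}[|\epsilon_{i,k}^j|^\delta\mid\mathcal{F}_k]\le\nu^\delta$ a.s. for all $i,k,j$. Under (i)–(iii) there is a unique Nash equilibrium $x^*$. *)

theory Defs
  imports "HOL-Probability.Probability"
begin

definition profiles :: "('n::finite \<Rightarrow> real set) \<Rightarrow> (real ^ 'n) set" where
  "profiles \<Omega> = {x. \<forall>i. x $ i \<in> \<Omega> i}"

definition set_coord :: "real ^ 'n::finite \<Rightarrow> 'n \<Rightarrow> real \<Rightarrow> real ^ 'n" where
  "set_coord x i t = (\<chi> j. if j = i then t else x $ j)"

definition partial_deriv :: "'n::finite \<Rightarrow> (real ^ 'n \<Rightarrow> real) \<Rightarrow> real ^ 'n \<Rightarrow> real" where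
  "partial_deriv i h x = deriv (\<lambda>t. h (set_coord x i t)) (x $ i)"

definition continuously_differentiable_on ::
    "('a::euclidean_space \<Rightarrow> real) \<Rightarrow> 'a set \<Rightarrow> bool" where
  "continuously_differentiable_on h U \<longleftrightarrow>
     (\<exists>G. continuous_on U G \<and> (\<forall>x\<in>U. (h has_derivative (\<lambda>v. G x \<bullet> v)) (at x)))"

definition pseudo_gradient :: "('n::finite \<Rightarrow> real ^ 'n \<Rightarrow> real) \<Rightarrow> real ^ 'n \<Rightarrow> real ^ 'n" where
  "pseudo_gradient J x = (\<chi> i. partial_deriv i (J i) x)"

definition nash_equilibrium ::
    "('n::finite \<Rightarrow> real set) \<Rightarrow> ('n \<Rightarrow> real ^ 'n \<Rightarrow> real) \<Rightarrow> real ^ 'n \<Rightarrow> bool" where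
  "nash_equilibrium \<Omega> J x \<longleftrightarrow>
     x \<in> profiles \<Omega> \<and> (\<forall>i. \<forall>t\<in>\<Omega> i. J i x \<le> J i (set_coord x i t))"

definition median :: "real list \<Rightarrow> real" where
  "median xs =
     (let ys = sort xs; n = length xs in
      if odd n then ys ! (n div 2) else (ys ! (n div 2 - 1) + ys ! (n div 2)) / 2)"

text \<open>
  In the following, \<open>B 1, \<dots>, B b\<close> are the blocks of sample indices, \<open>s\<close> is
  their common size, and \<open>g j\<close> is the gradient at the \<open>j\<close>-th sample.
\<close>

definition block_mean :: "nat \<Rightarrow> (nat \<Rightarrow> nat set) \<Rightarrow> (nat \<Rightarrow> real) \<Rightarrow> nat \<Rightarrow> real" where
  "block_mean s B g l = (1 / real s) * (\<Sum>j\<in>B l. g j)"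

definition median_of_means :: "nat \<Rightarrow> nat \<Rightarrow> (nat \<Rightarrow> nat set) \<Rightarrow> (nat \<Rightarrow> real) \<Rightarrow> real" where
  "median_of_means b s B g = median (map (block_mean s B g) [1..<Suc b])"

definition mean_of_means :: "nat \<Rightarrow> nat \<Rightarrow> (nat \<Rightarrow> nat set) \<Rightarrow> (nat \<Rightarrow> real) \<Rightarrow> real" where
  "mean_of_means b s B g = (1 / real b) * (\<Sum>l=1..b. block_mean s B g l)"

definition corrected_estimate ::
    "real \<Rightarrow> nat \<Rightarrow> nat \<Rightarrow> (nat \<Rightarrow> nat set) \<Rightarrow> (nat \<Rightarrow> real) \<Rightarrow> real" where
  "corrected_estimate \<eta> b s B g =
     (1 - \<eta>) * median_of_means b s B g + \<eta> * mean_of_means b s B g"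

definition raw_block_count :: "nat \<Rightarrow> real \<Rightarrow> nat" where
  "raw_block_count m \<gamma> = nat \<lfloor>min (8 * ln (exp (1 / 8) * inverse \<gamma>)) (real m / 2)\<rfloor>"

text \<open>
  The formula gives no block exactly when \<open>m = 1\<close> (for \<open>0 < \<gamma> \<le> 1\<close> and \<open>m > 0\<close>); then
  the single sample forms the only block.
\<close>

definition block_count :: "nat \<Rightarrow> real \<Rightarrow> nat" where
  "block_count m \<gamma> = (if raw_block_count m \<gamma> = 0 then 1 else raw_block_count m \<gamma>)"

definition block_size :: "nat \<Rightarrow> real \<Rightarrow> nat" where
  "block_size m \<gamma> = (if raw_block_count m \<gamma> = 0 then 1 else m div raw_block_count m \<gamma>)"

text \<open>
  The \<open>\<sigma>\<close>-algebra generated by the initial point and by all samples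
  \<open>\<xi> i k' j\<close> (player \<open>i\<close>, step \<open>k'\<close>, sample \<open>j \<in> {1..m k'}\<close>) drawn at the steps \<open>k' < k\<close>.
\<close>

definition history ::
    "'w measure \<Rightarrow> ('w \<Rightarrow> real ^ 'n::finite) \<Rightarrow> ('n \<Rightarrow> nat \<Rightarrow> nat \<Rightarrow> 'w \<Rightarrow> real) \<Rightarrow> (nat \<Rightarrow> nat)
       \<Rightarrow> nat \<Rightarrow> 'w measure" where
  "history M X0 \<xi> m k = sigma (space M)
     ({X0 -` A \<inter> space M | A. A \<in> sets borel} \<union>
      {\<xi> i k' j -` A \<inter> space M | i k' j A. k' < k \<and> j \<in> {1..m k'} \<and> A \<in> sets borel})"

end

theory Submission
  imports Defs "HOL-Real_Asymp.Real_Asymp"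
begin

text \<open>
  The projected gradient step is a contraction towards the equilibrium, up to the error of the
  gradient estimate. The proof separates a deterministic statement about such perturbed
  contractions from a probabilistic one about the error.

  Deterministic part. By convexity in the own action, the Nash equilibria are the solutions of the
  variational inequality for the pseudo-gradient \<open>F\<close>, taken coordinate by coordinate
  (\<open>nash_equilibrium_iff_variational\<close>). Brouwer's theorem provides a solution \<open>x\<^sup>*\<close>, strong
  monotonicity makes it unique, and \<open>x\<^sup>*\<close> is a fixed point of the exact projected step for every
  step size. Since projections do not increase distances, strong monotonicity and the Lipschitz
  bound give, for small \<open>\<alpha>\<^sub>k\<close>,
  \<open>\<parallel>x\<^sub>k\<^sub>+\<^sub>1 - x\<^sup>*\<parallel> \<le> (1 - \<alpha>\<^sub>k \<mu> / 2) \<parallel>x\<^sub>k - x\<^sup>*\<parallel> + \<alpha>\<^sub>k \<parallel>e\<^sub>k\<parallel>\<close>, where \<open>e\<^sub>k\<close> is the error of the gradient estimate.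
  As \<open>\<alpha>\<^sub>k \<rightarrow> 0\<close> and \<open>\<Sum>\<alpha>\<^sub>k = \<infinity>\<close>, it suffices that \<open>e\<^sub>k \<rightarrow> 0\<close>
  (\<open>inexact_projected_gradient_tendsto\<close>).

  Probabilistic part. The median and the mean of the block means both lie within the largest
  deviation of a block mean from the true gradient, and so does their convex combination, whatever
  its weight \<open>\<eta>\<^sub>k\<close>. So it suffices that all block means of step \<open>k\<close> converge simultaneously. Given
  the past, a block mean averages \<open>s\<^sub>k\<close> independent centred variables with bounded \<open>\<delta>\<close>-th moment; an
  inequality of von Bahr and Esseen (\<open>indep_sum_powr_moment\<close>, \<open>conditional_sum_powr_moment\<close>)
  bounds the \<open>\<delta>\<close>-th moment of its error by a multiple of \<open>s\<^sub>k powr (1 - \<delta>)\<close>. There are only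
  \<open>O(1 + log k)\<close> blocks, of size at least a multiple of \<open>k powr \<beta> / (1 + log k)\<close>. Hence the sum over all steps and
  blocks of these moments is at most a multiple of \<open>\<Sum>\<^sub>k (1 + log k)\<^sup>2 k powr (- \<beta> (\<delta> - 1))\<close>, which is
  finite because \<open>\<beta> (\<delta> - 1) > 1\<close>. A series of nonnegative variables with finite total expectation
  converges almost surely, so its terms tend to \<open>0\<close> almost surely, and with them \<open>e\<^sub>k\<close>.
\<close>

section \<open>Nash equilibria and variational inequalities\<close>

text \<open>
  The two first-order conditions below need this limit along the segment from \<open>x\<close> to \<open>y\<close> only, so they
  also hold when \<open>x\<close> is an endpoint of the interval on which the function is considered.
\<close>

lemma difference_quotient_tendsto_at_right:
  fixes h :: "real \<Rightarrow> real"
  assumes "(h has_real_derivative d) (at x)"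
  shows "((\<lambda>l. (h (x + l * (y - x)) - h x) / l) \<longlongrightarrow> d * (y - x)) (at_right 0)"
proof -
  have "((\<lambda>l. h (x + l * (y - x))) has_real_derivative d * (y - x)) (at 0)"
  proof -
    have "((\<lambda>l. x + l * (y - x)) has_real_derivative (y - x)) (at 0)"
      by (auto intro!: derivative_eq_intros)
    from DERIV_chain2[of h d "\<lambda>l. x + l * (y - x)" 0, OF _ this] assms show ?thesis by simp
  qed
  hence "((\<lambda>l. (h (x + l * (y - x)) - h x) / l) \<longlongrightarrow> d * (y - x)) (at 0)"
    by (simp add: has_field_derivative_iff)
  thus ?thesis by (rule filterlim_mono) (auto simp: at_le)
qed

lemma convex_on_above_tangent:
  fixes h :: "real \<Rightarrow> real"
  assumes conv: "convex_on S h" and S: "x \<in> S" "y \<in> S"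
    and d: "(h has_real_derivative d) (at x)"
  shows "h x + d * (y - x) \<le> h y"
proof -
  have "d * (y - x) \<le> h y - h x"
  proof (rule tendsto_upperbound[OF difference_quotient_tendsto_at_right[OF d]])
    have "(h (x + l * (y - x)) - h x) / l \<le> h y - h x" if "0 < l" "l < 1" for l
    proof -
      have "h ((1 - l) *\<^sub>R x + l *\<^sub>R y) \<le> (1 - l) * h x + l * h y"
        by (rule convex_onD[OF conv]) (use that S in auto)
      moreover have "(1 - l) *\<^sub>R x + l *\<^sub>R y = x + l * (y - x)" by (simp add: algebra_simps)
      ultimately have "h (x + l * (y - x)) - h x \<le> l * (h y - h x)" by (simp add: algebra_simps)
      thus ?thesis using that by (simp add: pos_divide_le_eq mult.commute)
    qed
    thus "\<forall>\<^sub>F l in at_right 0. (h (x + l * (y - x)) - h x) / l \<le> h y - h x"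
      using eventually_at_right_less[of 0]  by (auto simp: eventually_at_right_field intro!: exI[of _ 1])
  qed simp
  thus ?thesis by simp
qed

lemma convex_minimum_derivative_nonneg:
  fixes h :: "real \<Rightarrow> real"
  assumes S: "convex S" "x \<in> S" "y \<in> S" and min: "\<And>z. z \<in> S \<Longrightarrow> h x \<le> h z"
    and d: "(h has_real_derivative d) (at x)"
  shows "0 \<le> d * (y - x)"
proof (rule tendsto_lowerbound[OF difference_quotient_tendsto_at_right[OF d]])
  have "0 \<le> (h (x + l * (y - x)) - h x) / l" if "0 < l" "l < 1" for l
  proof -
    have "(1 - l) *\<^sub>R x + l *\<^sub>R y \<in> S" using S that by (intro convexD) auto
    moreover have "(1 - l) *\<^sub>R x + l *\<^sub>R y = x + l * (y - x)" by (simp add: algebra_simps)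
    ultimately show ?thesis using min that by simp
  qed
  thus "\<forall>\<^sub>F l in at_right 0. 0 \<le> (h (x + l * (y - x)) - h x) / l"
    by (auto simp: eventually_at_right_field intro!: exI[of _ 1])
qed simp

text \<open>
  In a nonempty product every coordinate value extends to a profile. Therefore compactness and convexity
  of the product pass to its factors.
\<close>

lemma profiles_coordinate_set:
  assumes "profiles \<Omega> \<noteq> {}"
  shows "\<Omega> i = (\<lambda>x. x $ i) ` profiles \<Omega>"
proof -
  obtain x where x: "x \<in> profiles \<Omega>" using assms by blast
  have "set_coord x i t \<in> profiles \<Omega> \<and> set_coord x i t $ i = t" if "t \<in> \<Omega> i" for t
    using x that by (auto simp: profiles_def set_coord_def)
  thus ?thesis by (force simp: profiles_def image_iff)
qed

lemma profiles_coordinate: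
  assumes "profiles \<Omega> \<noteq> {}" "convex (profiles \<Omega>)" "compact (profiles \<Omega>)"
  shows "\<Omega> i \<noteq> {}" "convex (\<Omega> i)" "closed (\<Omega> i)"
proof -
  have lin: "linear (\<lambda>x::real ^ 'a. x $ i)" by (simp add: linear_iff)
  note * = profiles_coordinate_set[OF assms(1), of i]
  show "\<Omega> i \<noteq> {}" using * assms(1) by simp
  show "convex (\<Omega> i)" unfolding * by (rule convex_linear_image[OF lin assms(2)])
  have "continuous_on (profiles \<Omega>) (\<lambda>x. x $ i)" by (intro continuous_intros)
  from compact_continuous_image[OF this assms(3)] show "closed (\<Omega> i)"
    unfolding * by (rule compact_imp_closed)
qed

lemma has_partial_derivative:
  assumes "continuously_differentiable_on h U" "x \<in> U"
  shows "((\<lambda>t. h (set_coord x i t)) has_real_derivative partial_deriv i h x) (at (x $ i))"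
proof -
  obtain G where G: "(h has_derivative (\<lambda>v. G \<bullet> v)) (at x)"
    using assms unfolding continuously_differentiable_on_def by blast
  have sc: "set_coord x i t = x + (t - x $ i) *\<^sub>R axis i 1" for t
    by (simp add: set_coord_def vec_eq_iff axis_def)
  have "((\<lambda>t. x + (t - x $ i) *\<^sub>R axis i 1) has_derivative (\<lambda>t. t *\<^sub>R axis i 1)) (at (x $ i))"
    by (auto intro!: derivative_eq_intros)
  from has_derivative_compose[OF this, of h "\<lambda>v. G \<bullet> v"] G
  have "((\<lambda>t. h (set_coord x i t)) has_derivative (\<lambda>t. G \<bullet> (t *\<^sub>R axis i 1))) (at (x $ i))"
    by (simp add: sc)
  moreover have "(\<lambda>t. G \<bullet> (t *\<^sub>R axis i 1)) = (*) (G \<bullet> axis i 1)" by (auto simp: fun_eq_iff)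
  ultimately have "((\<lambda>t. h (set_coord x i t)) has_real_derivative (G \<bullet> axis i 1)) (at (x $ i))"
    by (simp add: has_field_derivative_def)
  thus ?thesis unfolding partial_deriv_def by (metis DERIV_imp_deriv)
qed

text \<open>
  Each player solves a convex problem in one variable, and for such problems the first-order condition
  is both necessary and sufficient.
\<close>

lemma nash_equilibrium_iff_variational:
  assumes U: "profiles \<Omega> \<subseteq> U" and conv: "\<And>i. convex (\<Omega> i)"
    and C1: "\<And>i. continuously_differentiable_on (J i) U"
    and J_convex: "\<And>i x. x \<in> profiles \<Omega> \<Longrightarrow> convex_on (\<Omega> i) (\<lambda>t. J i (set_coord x i t))"
  shows "nash_equilibrium \<Omega> J x \<longleftrightarrow>
    x \<in> profiles \<Omega> \<and> (\<forall>i. \<forall>t\<in>\<Omega> i. 0 \<le> pseudo_gradient J x $ i * (t - x $ i))"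
proof (cases "x \<in> profiles \<Omega>")
  case True
  have xi: "x $ i \<in> \<Omega> i" and self: "set_coord x i (x $ i) = x" for i
    using True by (auto simp: profiles_def set_coord_def vec_eq_iff)
  have d: "((\<lambda>t. J i (set_coord x i t)) has_real_derivative pseudo_gradient J x $ i) (at (x $ i))" for i
    using has_partial_derivative[OF C1] True U by (auto simp: pseudo_gradient_def)
  have "(\<forall>t\<in>\<Omega> i. J i x \<le> J i (set_coord x i t)) \<longleftrightarrow> (\<forall>t\<in>\<Omega> i. 0 \<le> pseudo_gradient J x $ i * (t - x $ i))" for i
  proof (intro iffI ballI)
    fix t assume "\<forall>t\<in>\<Omega> i. J i x \<le> J i (set_coord x i t)" and t: "t \<in> \<Omega> i"
    thus "0 \<le> pseudo_gradient J x $ i * (t - x $ i)"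
      by (intro convex_minimum_derivative_nonneg[OF conv xi t _ d]) (simp add: self)
  next
    fix t assume "\<forall>t\<in>\<Omega> i. 0 \<le> pseudo_gradient J x $ i * (t - x $ i)" and t: "t \<in> \<Omega> i"
    thus "J i x \<le> J i (set_coord x i t)"
      using convex_on_above_tangent[OF J_convex[OF True] xi t d] by (fastforce simp: self)
  qed
  thus ?thesis using True by (simp add: nash_equilibrium_def)
qed (simp add: nash_equilibrium_def)

text \<open>
  The obtuse-angle characterisation of the projection of \<open>x - \<alpha> d\<close>. The right-hand side is free of \<open>\<alpha>\<close>:
  one equilibrium is a fixed point of the projected steps of all sizes.
\<close>

lemma closest_point_eq_iff_variational:
  fixes S :: "real set"
  assumes S: "convex S" "closed S" "x \<in> S" and \<alpha>: "0 < \<alpha>"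
  shows "closest_point S (x - \<alpha> * d) = x \<longleftrightarrow> (\<forall>t\<in>S. 0 \<le> d * (t - x))"
proof
  assume eq: "closest_point S (x - \<alpha> * d) = x"
  show "\<forall>t\<in>S. 0 \<le> d * (t - x)"
  proof
    fix t assume "t \<in> S"
    from closest_point_dot[OF S(1,2) this, of "x - \<alpha> * d"] eq
    have "0 \<le> \<alpha> * (d * (t - x))" by (simp add: algebra_simps)
    thus "0 \<le> d * (t - x)" using \<alpha> by (simp add: zero_le_mult_iff)
  qed
next
  assume vi: "\<forall>t\<in>S. 0 \<le> d * (t - x)"
  have "dist (x - \<alpha> * d) x \<le> dist (x - \<alpha> * d) t" if "t \<in> S" for t
  proof -
    have "0 \<le> \<alpha> * (d * (t - x))" using vi that \<alpha> by simp
    hence "(\<alpha> * d)\<^sup>2 \<le> (x - \<alpha> * d - t)\<^sup>2"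
      using zero_le_power2[of "x - t"] by (simp add: power2_eq_square algebra_simps)
    thus ?thesis by (simp add: dist_real_def abs_le_square_iff)
  qed
  thus "closest_point S (x - \<alpha> * d) = x"
    using closest_point_unique[OF S] by force
qed

text \<open>
  The map that performs one projected step of size 1 in every coordinate is continuous on the compact
  convex set of profiles; its Brouwer fixed points are the solutions.
\<close>

lemma variational_solution_exists:
  assumes \<Omega>: "profiles \<Omega> \<noteq> {}" "convex (profiles \<Omega>)" "compact (profiles \<Omega>)"
    and F: "continuous_on (profiles \<Omega>) F"
  obtains x where "x \<in> profiles \<Omega>" "\<And>i t. t \<in> \<Omega> i \<Longrightarrow> 0 \<le> F x $ i * (t - x $ i)"
proof -
  note co = profiles_coordinate[OF \<Omega>]
  define T where "T x = (\<chi> i. closest_point (\<Omega> i) (x $ i - 1 * F x $ i))" for x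
  have "continuous_on (profiles \<Omega>) T"
    unfolding T_def
    by (intro continuous_on_vec_lambda continuous_on_compose2[OF continuous_on_closest_point[OF co(2,3,1)]]
        continuous_intros F) (auto)
  moreover have "T \<in> profiles \<Omega> \<rightarrow> profiles \<Omega>"
    using closest_point_in_set[OF co(3,1)] by (auto simp: T_def profiles_def)
  ultimately obtain x where x: "x \<in> profiles \<Omega>" "T x = x"
    using brouwer[OF \<Omega>(3,2,1)] by metis
  have "\<forall>t\<in>\<Omega> i. 0 \<le> F x $ i * (t - x $ i)" for i
  proof -
    have "x $ i \<in> \<Omega> i" using x(1) by (simp add: profiles_def)
    moreover have "closest_point (\<Omega> i) (x $ i - 1 * F x $ i) = x $ i"
      using arg_cong[OF x(2), of "\<lambda>v. v $ i"] by (simp add: T_def)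
    ultimately show ?thesis using closest_point_eq_iff_variational[OF co(2,3), of "x $ i" i 1] by simp
  qed
  thus thesis using that x(1) by blast
qed

text \<open>
  Adding the inequality at \<open>x\<close>, tested against \<open>y\<close>, to the one at \<open>y\<close>, tested against \<open>x\<close>, contradicts
  strong monotonicity unless \<open>x = y\<close>.
\<close>

lemma variational_solution_unique:
  assumes mono: "\<mu> * (norm (x - y))\<^sup>2 \<le> (F x - F y) \<bullet> (x - y)" and \<mu>: "0 < \<mu>"
    and x: "x \<in> profiles \<Omega>" "\<And>i t. t \<in> \<Omega> i \<Longrightarrow> 0 \<le> F x $ i * (t - x $ i)"
    and y: "y \<in> profiles \<Omega>" "\<And>i t. t \<in> \<Omega> i \<Longrightarrow> 0 \<le> F y $ i * (t - y $ i)"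
  shows "x = y"
proof -
  have "0 \<le> F x \<bullet> (y - x)" "0 \<le> F y \<bullet> (x - y)"
    using x y by (auto simp: inner_vec_def profiles_def intro!: sum_nonneg)
  hence "(F x - F y) \<bullet> (x - y) \<le> 0" by (simp add: inner_diff_left inner_diff_right)
  hence "\<mu> * (norm (x - y))\<^sup>2 \<le> 0" using mono by linarith
  thus "x = y" using \<mu> by (simp add: mult_le_0_iff)
qed

section \<open>Projected gradient steps with a vanishing error\<close>

lemma partial_sums_at_top:
  fixes p :: "nat \<Rightarrow> real"
  assumes p: "\<And>k. 0 \<le> p k" "\<not> summable p"
  shows "filterlim (\<lambda>n. \<Sum>j<n. p j) at_top sequentially"
  unfolding filterlim_at_top
proof (rule allI, rule ccontr)
  fix Z assume n: "\<not> (\<forall>\<^sub>F n in sequentially. Z \<le> (\<Sum>j<n. p j))"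
  have "(\<Sum>j<n. p j) \<le> Z" for n
  proof (rule ccontr)
    assume *: "\<not> (\<Sum>j<n. p j) \<le> Z"
    have "Z \<le> (\<Sum>j<N. p j)" if "n \<le> N" for N
    proof -
      have "(\<Sum>j<n. p j) \<le> (\<Sum>j<N. p j)" using that p(1) by (intro sum_mono2) auto
      thus ?thesis using * by linarith
    qed
    thus False using n unfolding eventually_sequentially by blast
  qed
  hence "summable p" using p(1) by (intro summableI_nonneg_bounded[of _ Z])
  thus False using p(2) by simp
qed

text \<open>
  Eventually each step replaces \<open>u k\<close> by at most a weighted average of \<open>u k\<close> and \<open>r k\<close>. Once \<open>r k\<close> stays below
  \<open>e / 2\<close>, the excess of \<open>u\<close> over \<open>e / 2\<close> shrinks by factors \<open>1 - p k \<le> exp (- p k)\<close>, whose infinite product is \<open>0\<close>.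
\<close>

lemma contraction_with_vanishing_error:
  fixes u p r :: "nat \<Rightarrow> real"
  assumes u0: "\<And>k. 0 \<le> u k" and p: "\<And>k. 0 \<le> p k" "p \<longlonglongrightarrow> 0" "\<not> summable p"
    and r: "r \<longlonglongrightarrow> 0"
    and rec: "\<forall>\<^sub>F k in sequentially. u (Suc k) \<le> (1 - p k) * u k + p k * r k"
  shows "u \<longlonglongrightarrow> 0"
proof (rule LIMSEQ_I)
  fix e :: real assume e: "0 < e"
  have "\<forall>\<^sub>F k in sequentially. u (Suc k) \<le> (1 - p k) * u k + p k * r k \<and> p k < 1 \<and> r k < e / 2"
    using rec order_tendstoD(2)[OF p(2), of 1] order_tendstoD(2)[OF r, of "e / 2"] e
    by (auto simp: eventually_conj_iff)
  then obtain K where K: "\<And>k. K \<le> k \<Longrightarrow> u (Suc k) \<le> (1 - p k) * u k + p k * r k \<and> p k < 1 \<and> r k < e / 2"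
    unfolding eventually_sequentially by blast
  have step: "u (K + n) - e / 2 \<le> exp (- (\<Sum>j<n. p (K + j))) * u K" for n
  proof (induction n)
    case 0 show ?case using e by simp
  next
    case (Suc n)
    have "u (K + Suc n) \<le> (1 - p (K + n)) * u (K + n) + p (K + n) * r (K + n)"
      using K[of "K + n"] by simp
    also have "\<dots> \<le> (1 - p (K + n)) * u (K + n) + p (K + n) * (e / 2)"
      using K[of "K + n"] p(1)[of "K + n"] by (intro add_left_mono mult_left_mono) auto
    finally have "u (K + Suc n) - e / 2 \<le> (1 - p (K + n)) * (u (K + n) - e / 2)"
      by (simp add: algebra_simps)
    also have "\<dots> \<le> (1 - p (K + n)) * (exp (- (\<Sum>j<n. p (K + j))) * u K)"
      using Suc K[of "K + n"] by (intro mult_left_mono) auto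
    also have "\<dots> \<le> exp (- p (K + n)) * (exp (- (\<Sum>j<n. p (K + j))) * u K)"
      using u0[of K] exp_ge_add_one_self[of "- p (K + n)"] by (intro mult_right_mono) auto
    finally show ?case by (simp add: exp_add[symmetric] algebra_simps)
  qed
  have "\<not> summable (\<lambda>j. p (K + j))" using p(3) summable_iff_shift[of p K] by (simp add: add.commute)
  hence "filterlim (\<lambda>n. \<Sum>j<n. p (K + j)) at_top sequentially"
    using p(1) by (intro partial_sums_at_top)
  hence "(\<lambda>n. exp (- (\<Sum>j<n. p (K + j))) * u K) \<longlonglongrightarrow> 0 * u K"
    by (intro tendsto_mult tendsto_const filterlim_compose[OF exp_at_bot])
       (simp add: filterlim_uminus_at_bot)
  hence "\<forall>\<^sub>F n in sequentially. exp (- (\<Sum>j<n. p (K + j))) * u K < e / 2"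
    using e by (intro order_tendstoD(2)) auto
  then obtain N where N: "\<And>n. N \<le> n \<Longrightarrow> exp (- (\<Sum>j<n. p (K + j))) * u K < e / 2"
    unfolding eventually_sequentially by blast
  have "u n < e" if "K + N \<le> n" for n
    using N[of "n - K"] step[of "n - K"] that by fastforce
  thus "\<exists>n0. \<forall>n\<ge>n0. norm (u n - 0) < e" using u0 by (auto intro!: exI[of _ "K + N"])
qed

text \<open>
  Expanding the square, strong monotonicity contributes \<open>- 2 \<alpha> \<mu>\<close> and the Lipschitz bound \<open>\<alpha>\<^sup>2 L\<^sup>2\<close>, of
  which the former dominates for small \<open>\<alpha>\<close>.
\<close>

lemma gradient_step_contraction:
  fixes x y :: "'a::real_inner"
  assumes mono: "\<mu> * (norm (x - y))\<^sup>2 \<le> (F x - F y) \<bullet> (x - y)"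
    and lip: "norm (F x - F y) \<le> L * norm (x - y)"
    and \<alpha>: "0 \<le> \<alpha>" "\<alpha> * L\<^sup>2 \<le> \<mu>" "\<alpha> * \<mu> \<le> 1"
  shows "norm (x - y - \<alpha> *\<^sub>R (F x - F y)) \<le> (1 - \<alpha> * \<mu> / 2) * norm (x - y)"
proof (rule power2_le_imp_le)
  let ?u = "norm (x - y)"
  have "(norm (x - y - \<alpha> *\<^sub>R (F x - F y)))\<^sup>2
      = ?u\<^sup>2 - 2 * \<alpha> * ((F x - F y) \<bullet> (x - y)) + \<alpha>\<^sup>2 * (norm (F x - F y))\<^sup>2"
    unfolding power2_norm_eq_inner
    by (simp add: inner_diff_left inner_diff_right inner_commute algebra_simps power2_eq_square)
  also have "\<dots> \<le> ?u\<^sup>2 - 2 * \<alpha> * (\<mu> * ?u\<^sup>2) + \<alpha>\<^sup>2 * (L * ?u)\<^sup>2"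
    using mono lip \<alpha>(1) by (intro add_mono diff_mono mult_left_mono power_mono) auto
  also have "\<alpha>\<^sup>2 * (L * ?u)\<^sup>2 = \<alpha> * ((\<alpha> * L\<^sup>2) * ?u\<^sup>2)" by (simp add: power2_eq_square)
  also have "\<dots> \<le> \<alpha> * (\<mu> * ?u\<^sup>2)" using \<alpha> by (intro mult_left_mono mult_right_mono) auto
  also have "?u\<^sup>2 - 2 * \<alpha> * (\<mu> * ?u\<^sup>2) + \<alpha> * (\<mu> * ?u\<^sup>2) \<le> ((1 - \<alpha> * \<mu> / 2) * ?u)\<^sup>2"
  proof -
    have "((1 - \<alpha> * \<mu> / 2) * ?u)\<^sup>2 = ?u\<^sup>2 - 2 * \<alpha> * (\<mu> * ?u\<^sup>2) + \<alpha> * (\<mu> * ?u\<^sup>2) + (\<alpha> * \<mu> * ?u / 2)\<^sup>2"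
      by (simp add: power2_eq_square algebra_simps)
    thus ?thesis by simp
  qed
  finally show "(norm (x - y - \<alpha> *\<^sub>R (F x - F y)))\<^sup>2 \<le> ((1 - \<alpha> * \<mu> / 2) * ?u)\<^sup>2" by simp
qed (use \<alpha> in auto)

text \<open>
  The equilibrium \<open>y\<close> is a fixed point of the exact step and projections are nonexpansive, so the
  distance to \<open>y\<close> contracts as in \<open>gradient_step_contraction\<close> up to the additional error
  \<open>\<alpha> k * norm (G k - F (x k))\<close>. In \<open>contraction_with_vanishing_error\<close> this is used with \<open>p k = \<mu> / 2 * \<alpha> k\<close> and
  \<open>r k = 2 / \<mu> * norm (G k - F (x k))\<close>.
\<close>

lemma inexact_projected_gradient_tendsto:
  fixes x G :: "nat \<Rightarrow> real ^ 'n::finite" and \<alpha> :: "nat \<Rightarrow> real"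
  assumes \<Omega>: "profiles \<Omega> \<noteq> {}" "convex (profiles \<Omega>)" "compact (profiles \<Omega>)"
    and \<mu>: "0 < \<mu>"
    and mono: "\<And>x y. x \<in> profiles \<Omega> \<Longrightarrow> y \<in> profiles \<Omega> \<Longrightarrow>
          \<mu> * (norm (x - y))\<^sup>2 \<le> (F x - F y) \<bullet> (x - y)"
    and lip: "L-lipschitz_on (profiles \<Omega>) F"
    and \<alpha>: "\<And>k. 0 < \<alpha> k" "\<alpha> \<longlonglongrightarrow> 0" "\<not> summable \<alpha>"
    and x: "\<And>k. x k \<in> profiles \<Omega>"
    and step: "\<And>k i. x (Suc k) $ i = closest_point (\<Omega> i) (x k $ i - \<alpha> k * G k $ i)"
    and G: "(\<lambda>k. G k - F (x k)) \<longlonglongrightarrow> 0"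
    and y: "y \<in> profiles \<Omega>" "\<And>i t. t \<in> \<Omega> i \<Longrightarrow> 0 \<le> F y $ i * (t - y $ i)"
  shows "(\<lambda>k. norm (x k - y)) \<longlonglongrightarrow> 0"
proof (rule contraction_with_vanishing_error)
  note co = profiles_coordinate[OF \<Omega>]
  show "0 \<le> \<mu> / 2 * \<alpha> k" for k using \<mu> \<alpha>(1)[of k] by simp
  show "(\<lambda>k. \<mu> / 2 * \<alpha> k) \<longlonglongrightarrow> 0" by (rule tendsto_mult_right_zero[OF \<alpha>(2)])
  show "\<not> summable (\<lambda>k. \<mu> / 2 * \<alpha> k)" using \<mu> \<alpha>(3) by (simp add: summable_cmult_iff)
  show "(\<lambda>k. 2 / \<mu> * norm (G k - F (x k))) \<longlonglongrightarrow> 0"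
    by (rule tendsto_mult_right_zero[OF tendsto_norm_zero[OF G]])
  have "\<forall>\<^sub>F k in sequentially. \<alpha> k * L\<^sup>2 < \<mu>"
    using tendsto_mult_left_zero[OF \<alpha>(2)] \<mu> by (intro order_tendstoD(2)) auto
  moreover have "\<forall>\<^sub>F k in sequentially. \<alpha> k * \<mu> < 1"
    using tendsto_mult_left_zero[OF \<alpha>(2)] by (intro order_tendstoD(2)) auto
  ultimately show "\<forall>\<^sub>F k in sequentially. norm (x (Suc k) - y)
      \<le> (1 - \<mu> / 2 * \<alpha> k) * norm (x k - y) + \<mu> / 2 * \<alpha> k * (2 / \<mu> * norm (G k - F (x k)))"
  proof eventually_elim
    case (elim k)
    let ?z = "x k - y - \<alpha> k *\<^sub>R (F (x k) - F y)"
    have "norm (x (Suc k) - y) \<le> norm (?z - \<alpha> k *\<^sub>R (G k - F (x k)))"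
    proof (rule norm_le_componentwise_cart)
      fix i
      have yi: "y $ i \<in> \<Omega> i" using y(1) by (simp add: profiles_def)
      have "y $ i = closest_point (\<Omega> i) (y $ i - \<alpha> k * F y $ i)"
        using closest_point_eq_iff_variational[OF co(2,3) yi \<alpha>(1)[of k], of "F y $ i"] y(2) by simp
      with step[of k i] closest_point_lipschitz[OF co(2,3,1), of i "x k $ i - \<alpha> k * G k $ i" "y $ i - \<alpha> k * F y $ i"]
      have "\<bar>x (Suc k) $ i - y $ i\<bar> \<le> \<bar>(x k $ i - \<alpha> k * G k $ i) - (y $ i - \<alpha> k * F y $ i)\<bar>"
        by (simp add: dist_real_def)
      thus "norm ((x (Suc k) - y) $ i) \<le> norm ((?z - \<alpha> k *\<^sub>R (G k - F (x k))) $ i)"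
        by (simp add: algebra_simps)
    qed
    also have "\<dots> \<le> norm ?z + \<alpha> k * norm (G k - F (x k))"
      using norm_triangle_ineq4[of ?z "\<alpha> k *\<^sub>R (G k - F (x k))"] \<alpha>(1)[of k] by simp
    also have "norm ?z \<le> (1 - \<alpha> k * \<mu> / 2) * norm (x k - y)"
      using elim \<alpha>(1)[of k] lipschitz_onD[OF lip x[of k] y(1)] mono[OF x y(1)]
      by (intro gradient_step_contraction) (auto simp: dist_norm)
    finally show ?case using \<mu> by (simp add: mult_ac)
  qed
qed simp

section \<open>Moments of sums of independent variables\<close>

lemma abs_powr_diff_le:
  fixes x y p :: real
  assumes "0 \<le> x" "0 \<le> y" "0 < p" "p \<le> 1"
  shows "\<bar>x powr p - y powr p\<bar> \<le> \<bar>x - y\<bar> powr p"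
proof -
  have sub: "(u + v) powr p \<le> u powr p + v powr p" if uv: "0 < u" "0 < v" for u v :: real
  proof -
    have q: "t \<le> t powr p" if "0 < t" "t \<le> 1" for t :: real
      using powr_mono'[of p 1 t] that assms by simp
    have "1 = u / (u + v) + v / (u + v)" using uv by (simp add: add_divide_distrib[symmetric])
    also have "\<dots> \<le> (u / (u + v)) powr p + (v / (u + v)) powr p"
      using uv by (intro add_mono q) auto
    also have "\<dots> = (u powr p + v powr p) / (u + v) powr p"
      using uv by (simp add: powr_divide add_divide_distrib)
    finally show ?thesis using uv by (simp add: le_divide_eq)
  qed
  have *: "v powr p - u powr p \<le> (v - u) powr p \<and> u powr p \<le> v powr p" if "0 \<le> u" "u \<le> v" for u v :: real
    using sub[of u "v - u"] powr_mono2[of p u v] that assms by (cases "u = 0"; cases "u = v") auto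
  show ?thesis using *[of x y] *[of y x] assms by (cases "x \<le> y") auto
qed

text \<open>
  A Taylor expansion of \<open>\<lambda>x. \<bar>x\<bar> powr p\<close> whose linear term is exact, so that it vanishes in expectation
  when \<open>y\<close> is centred and independent of \<open>x\<close>. By convexity the remainder is at most \<open>y\<close> times the change
  of the derivative between \<open>x\<close> and \<open>x + y\<close>; the derivative is Hoelder continuous with exponent
  \<open>p - 1\<close>, which leaves a multiple of \<open>\<bar>y\<bar> powr p\<close>. If \<open>x + y\<close> has changed sign, then \<open>\<bar>x\<bar> \<le> \<bar>y\<bar>\<close> and every
  term is of this size already.
\<close>

lemma abs_powr_add_le:
  fixes x y p :: real
  assumes p: "1 < p" "p \<le> 2"
  shows "\<bar>x + y\<bar> powr p \<le> \<bar>x\<bar> powr p + p * (sgn x * \<bar>x\<bar> powr (p - 1)) * y + 3 * \<bar>y\<bar> powr p"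
proof -
  have mul: "\<bar>u\<bar> * \<bar>u\<bar> powr (p - 1) = \<bar>u\<bar> powr p" for u :: real
    using powr_mult_base[of "\<bar>u\<bar>" "p - 1"] by simp
  have pos: "\<bar>x + y\<bar> powr p \<le> x powr p + p * x powr (p - 1) * y + 3 * \<bar>y\<bar> powr p" if x: "0 < x" for x y
  proof (cases "0 < x + y")
    case True
    have "(x + y) powr p + (p * (x + y) powr (p - 1)) * (x - (x + y)) \<le> x powr p"
    proof (rule convex_on_above_tangent)
      show "convex_on {0<..} (\<lambda>x. x powr p)" using powr_convex[of p] p by simp
      show "((\<lambda>x. x powr p) has_real_derivative p * (x + y) powr (p - 1)) (at (x + y))"
        using True by (auto intro!: derivative_eq_intros)
    qed (use True x in auto)
    hence "(x + y) powr p \<le> x powr p + p * x powr (p - 1) * y + p * (((x + y) powr (p - 1) - x powr (p - 1)) * y)"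
      by (simp add: algebra_simps)
    also have "((x + y) powr (p - 1) - x powr (p - 1)) * y \<le> \<bar>(x + y) powr (p - 1) - x powr (p - 1)\<bar> * \<bar>y\<bar>"
      by (metis abs_ge_self abs_mult)
    also have "\<dots> \<le> \<bar>y\<bar> powr (p - 1) * \<bar>y\<bar>"
      using abs_powr_diff_le[of "x + y" x "p - 1"] True x p by (intro mult_right_mono) auto
    also have "\<dots> = \<bar>y\<bar> powr p" using mul by (simp add: mult.commute)
    also have "p * \<bar>y\<bar> powr p \<le> 3 * \<bar>y\<bar> powr p" using p by (intro mult_right_mono) auto
    finally show ?thesis using True p by simp
  next
    case False
    have "\<bar>x + y\<bar> powr p \<le> \<bar>y\<bar> powr p" using False x p by (intro powr_mono2) auto
    moreover have "- (p * x powr (p - 1) * y) \<le> 2 * \<bar>y\<bar> powr p"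
    proof -
      have "- (p * x powr (p - 1) * y) = p * (x powr (p - 1) * \<bar>y\<bar>)"
        using False x by simp
      also have "\<dots> \<le> 2 * (\<bar>y\<bar> powr (p - 1) * \<bar>y\<bar>)"
        using False x p by (intro mult_mono powr_mono2 mult_nonneg_nonneg) auto
      also have "\<dots> = 2 * \<bar>y\<bar> powr p" using mul by (simp add: mult.commute)
      finally show ?thesis .
    qed
    moreover have "0 \<le> x powr p" by simp
    ultimately show ?thesis by linarith
  qed
  \<comment> \<open>Both sides are unchanged when the signs of \<open>x\<close> and \<open>y\<close> are flipped.\<close>
  consider "x > 0" | "x = 0" | "x < 0" by linarith
  thus ?thesis
  proof cases
    case 3
    have "\<bar>- x + - y\<bar> = \<bar>x + y\<bar>" by linarith
    thus ?thesis using pos[of "-x" "-y"] 3 by simp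
  qed (use pos[of x y] in auto)
qed

lemma (in finite_measure) integrable_of_powr_moment:
  fixes Y :: "'a \<Rightarrow> real"
  assumes Y: "Y \<in> borel_measurable M" and p: "1 \<le> p" and mom: "integrable M (\<lambda>w. \<bar>Y w\<bar> powr p)"
  shows "integrable M Y"
proof (rule Bochner_Integration.integrable_bound)
  show "integrable M (\<lambda>w. 1 + \<bar>Y w\<bar> powr p)" using mom by simp
  have "\<bar>x\<bar> \<le> 1 + \<bar>x\<bar> powr p" for x :: real
    using powr_mono[of 1 p "\<bar>x\<bar>"] p powr_ge_zero[of "\<bar>x\<bar>" p]
    by (cases "\<bar>x\<bar> \<le> 1") (auto simp del: powr_ge_zero)
  thus "AE w in M. norm (Y w) \<le> norm (1 + \<bar>Y w\<bar> powr p)"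
    by (auto intro: order_trans[OF _ abs_ge_self])
qed (rule Y)

text \<open>
  The inequality of von Bahr and Esseen. The \<open>p\<close>-th moments of independent centred variables
  add up, up to a constant, as variances do for \<open>p = 2\<close>: when a summand is added, the linear term
  of \<open>abs_powr_add_le\<close> has expectation \<open>0\<close>.
\<close>

lemma (in prob_space) indep_sum_powr_moment:
  fixes Y :: "'i \<Rightarrow> 'a \<Rightarrow> real"
  assumes p: "1 < p" "p \<le> 2" and fin: "finite I" and indep: "indep_vars (\<lambda>_. borel) Y I"
    and mom: "\<And>i. i \<in> I \<Longrightarrow> integrable M (\<lambda>w. \<bar>Y i w\<bar> powr p)"
    and mean: "\<And>i. i \<in> I \<Longrightarrow> expectation (Y i) = 0"
  shows "integrable M (\<lambda>w. \<bar>\<Sum>i\<in>I. Y i w\<bar> powr p) \<and>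
    expectation (\<lambda>w. \<bar>\<Sum>i\<in>I. Y i w\<bar> powr p) \<le> 3 * (\<Sum>i\<in>I. expectation (\<lambda>w. \<bar>Y i w\<bar> powr p))"
proof -
  have int: "integrable M (Y i)" if "i \<in> I" for i
  proof (rule integrable_of_powr_moment[OF _ _ mom[OF that]])
    show "Y i \<in> borel_measurable M" using indep that by (auto simp: indep_vars_def)
  qed (use p in simp)
  show ?thesis
    using fin indep int mom mean
  proof (induction I rule: finite_induct)
    case empty
    show ?case by simp
  next
    case (insert i I)
    define S where "S w = (\<Sum>i\<in>I. Y i w)" for w
    define \<phi> where "\<phi> x = p * (sgn x * \<bar>x\<bar> powr (p - 1))" for x :: real
    have IH: "integrable M (\<lambda>w. \<bar>S w\<bar> powr p)"
      "expectation (\<lambda>w. \<bar>S w\<bar> powr p) \<le> 3 * (\<Sum>i\<in>I. expectation (\<lambda>w. \<bar>Y i w\<bar> powr p))"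
      unfolding S_def using insert.IH[OF indep_vars_subset[OF insert.prems(1)]] insert.prems by auto
    have [measurable]: "Y j \<in> borel_measurable M" if "j \<in> insert i I" for j
      using insert.prems(2)[OF that] by simp
    have S[measurable]: "S \<in> borel_measurable M" unfolding S_def by measurable
    have \<phi>[measurable]: "\<phi> \<in> borel_measurable borel" unfolding \<phi>_def by measurable
    have int_\<phi>: "integrable M (\<lambda>w. \<phi> (S w))"
    proof (rule Bochner_Integration.integrable_bound)
      show "integrable M (\<lambda>w. p * (1 + \<bar>S w\<bar> powr p))" using IH(1) by simp
      have *: "\<bar>x\<bar> powr (p - 1) \<le> 1 + \<bar>x\<bar> powr p" for x :: real
      proof (cases "\<bar>x\<bar> \<le> 1")
        case True
        hence "\<bar>x\<bar> powr (p - 1) \<le> 1" using p by (simp add: powr_le1)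
        thus ?thesis using powr_ge_zero[of "\<bar>x\<bar>" p] by linarith
      next
        case False
        hence "\<bar>x\<bar> powr (p - 1) \<le> \<bar>x\<bar> powr p" using p by (intro powr_mono) auto
        thus ?thesis by simp
      qed
      have "\<bar>sgn x\<bar> * \<bar>x\<bar> powr (p - 1) \<le> 1 + \<bar>x\<bar> powr p" for x :: real
        using *[of x] by (cases "x = 0") (auto simp: abs_sgn_eq)
      thus "AE w in M. norm (\<phi> (S w)) \<le> norm (p * (1 + \<bar>S w\<bar> powr p))"
        using p by (intro AE_I2) (simp add: \<phi>_def abs_mult)
    qed simp
    have "indep_var borel (Y i) borel S"
      unfolding S_def using indep_vars_sum[OF insert.hyps(1,2) insert.prems(1)] .
    hence ind: "indep_var borel (\<lambda>w. Y i w) borel (\<lambda>w. \<phi> (S w))"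
      using indep_var_compose[of borel "Y i" borel S "\<lambda>x. x" borel \<phi> borel] by (simp add: comp_def)
    have cross: "integrable M (\<lambda>w. Y i w * \<phi> (S w))" "expectation (\<lambda>w. Y i w * \<phi> (S w)) = 0"
      using indep_var_integrable[OF ind _ int_\<phi>] indep_var_lebesgue_integral[OF ind _ int_\<phi>] insert.prems
      by auto
    let ?R = "\<lambda>w. \<bar>S w\<bar> powr p + Y i w * \<phi> (S w) + 3 * \<bar>Y i w\<bar> powr p"
    have R: "integrable M ?R" using IH(1) cross insert.prems(3) by auto
    have le: "\<bar>S w + Y i w\<bar> powr p \<le> ?R w" for w
      using abs_powr_add_le[OF p, of "S w" "Y i w"] by (simp add: \<phi>_def mult_ac)
    have sum: "(\<Sum>j\<in>insert i I. Y j w) = S w + Y i w" for w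
      using insert.hyps by (simp add: S_def)
    have int: "integrable M (\<lambda>w. \<bar>S w + Y i w\<bar> powr p)"
      by (rule Bochner_Integration.integrable_bound[OF R]) (use le in \<open>auto intro: order_trans[OF _ abs_ge_self]\<close>)
    have "expectation (\<lambda>w. \<bar>S w + Y i w\<bar> powr p) \<le> expectation ?R"
      by (rule integral_mono[OF int R le])
    also have "\<dots> = expectation (\<lambda>w. \<bar>S w\<bar> powr p) + 3 * expectation (\<lambda>w. \<bar>Y i w\<bar> powr p)"
      using IH(1) cross insert.prems(3) by simp
    finally show ?case using IH(2) int insert.hyps by (simp add: sum algebra_simps)
  qed
qed

section \<open>Samples independent of the past\<close>

text \<open>
  Independence of a \<open>\<sigma>\<close>-algebra \<open>F\<close> and a variable \<open>Y\<close> as a product formula for the joint law. The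
  identity map, seen as a variable with values in \<open>F\<close>, stands for the entire past.
\<close>

lemma (in prob_space) joint_distr_indep_set:
  assumes sub: "subalgebra M F" and Y[measurable]: "Y \<in> measurable M T"
    and ind: "indep_set (sets F) (sets (vimage_algebra (space M) Y T))"
  shows "distr M F (\<lambda>w. w) \<Otimes>\<^sub>M distr M T Y = distr M (F \<Otimes>\<^sub>M T) (\<lambda>w. (w, Y w))"
proof (rule pair_measure_eqI)
  have F: "space F = space M" "sets F \<subseteq> sets M" using sub by (auto simp: subalgebra_def)
  have [measurable]: "(\<lambda>w. w) \<in> measurable M F"
    by (rule measurable_from_subalg[OF sub]) simp
  interpret PF: prob_space "distr M F (\<lambda>w. w)" by (rule prob_space_distr) simp
  interpret PY: prob_space "distr M T Y" by (rule prob_space_distr) simp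
  show "sigma_finite_measure (distr M F (\<lambda>w. w))" "sigma_finite_measure (distr M T Y)" by unfold_locales
  fix A B assume "A \<in> sets (distr M F (\<lambda>w. w))" "B \<in> sets (distr M T Y)"
  hence AB[measurable]: "A \<in> sets F" "B \<in> sets T" by auto
  have A: "A \<subseteq> space M" using sets.sets_into_space[OF AB(1)] F by simp
  have "Y -` B \<inter> space M \<in> sets (vimage_algebra (space M) Y T)"
    using in_vimage_algebra[OF AB(2)] .
  with ind AB(1) have "prob (A \<inter> (Y -` B \<inter> space M)) = prob A * prob (Y -` B \<inter> space M)"
    by (rule indep_setD)
  moreover have "(\<lambda>w. (w, Y w)) -` (A \<times> B) \<inter> space M = A \<inter> (Y -` B \<inter> space M)"
    "(\<lambda>w. w) -` A \<inter> space M = A" using A by auto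
  ultimately show "emeasure (distr M F (\<lambda>w. w)) A * emeasure (distr M T Y) B
      = emeasure (distr M (F \<Otimes>\<^sub>M T) (\<lambda>w. (w, Y w))) (A \<times> B)"
    by (simp add: emeasure_distr emeasure_eq_measure ennreal_mult)
qed simp

text \<open>
  By Fubini, a variable independent of the past may be replaced by an independent copy, which is realised by
  a second integration over the same probability space.
\<close>

lemma (in prob_space) nn_integral_decouple:
  assumes sub: "subalgebra M F" and Y[measurable]: "Y \<in> measurable M T"
    and ind: "indep_set (sets F) (sets (vimage_algebra (space M) Y T))"
    and [measurable]: "\<Phi> \<in> borel_measurable (F \<Otimes>\<^sub>M T)"
  shows "(\<integral>\<^sup>+w. \<Phi> (w, Y w) \<partial>M) = (\<integral>\<^sup>+w. \<integral>\<^sup>+w'. \<Phi> (w, Y w') \<partial>M \<partial>M)"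
proof -
  have [measurable]: "(\<lambda>w. w) \<in> measurable M F"
    by (rule measurable_from_subalg[OF sub]) simp
  interpret PF: prob_space "distr M F (\<lambda>w. w)" by (rule prob_space_distr) simp
  interpret PY: prob_space "distr M T Y" by (rule prob_space_distr) simp
  have "(\<integral>\<^sup>+w. \<Phi> (w, Y w) \<partial>M) = (\<integral>\<^sup>+z. \<Phi> z \<partial>distr M (F \<Otimes>\<^sub>M T) (\<lambda>w. (w, Y w)))"
    by (simp add: nn_integral_distr)
  also have "\<dots> = (\<integral>\<^sup>+x. \<integral>\<^sup>+y. \<Phi> (x, y) \<partial>distr M T Y \<partial>distr M F (\<lambda>w. w))"
    unfolding joint_distr_indep_set[OF sub Y ind, symmetric] by (rule PY.nn_integral_fst[symmetric]) simp
  also have "\<dots> = (\<integral>\<^sup>+w. \<integral>\<^sup>+y. \<Phi> (w, y) \<partial>distr M T Y \<partial>M)" by (rule nn_integral_distr) measurable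
  also have "\<dots> = (\<integral>\<^sup>+w. \<integral>\<^sup>+w'. \<Phi> (w, Y w') \<partial>M \<partial>M)"
    using sub by (intro nn_integral_cong nn_integral_distr) (auto simp: subalgebra_def)
  finally show ?thesis .
qed

text \<open>
  Conditioning on \<open>F\<close> means freezing the arguments that depend on the past and averaging over the rest.
\<close>

lemma (in prob_space) real_cond_exp_decouple:
  fixes \<Phi> :: "_ \<Rightarrow> real"
  assumes sub: "subalgebra M F" and Y[measurable]: "Y \<in> measurable M T"
    and ind: "indep_set (sets F) (sets (vimage_algebra (space M) Y T))"
    and \<Phi>[measurable]: "\<Phi> \<in> borel_measurable (F \<Otimes>\<^sub>M T)"
    and int: "integrable M (\<lambda>w. \<Phi> (w, Y w))"
  shows "AE w in M. real_cond_exp M F (\<lambda>w. \<Phi> (w, Y w)) w = (\<integral>w'. \<Phi> (w, Y w') \<partial>M)"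
proof -
  interpret finite_measure_subalgebra M F by unfold_locales (rule sub)
  have sp: "space F = space M" using sub by (simp add: subalgebra_def)
  have id[measurable]: "(\<lambda>w. w) \<in> measurable M F"
    by (rule measurable_from_subalg[OF sub]) simp
  interpret PF: prob_space "distr M F (\<lambda>w. w)" by (rule prob_space_distr) simp
  interpret PY: prob_space "distr M T Y" by (rule prob_space_distr) simp
  interpret P: pair_sigma_finite "distr M F (\<lambda>w. w)" "distr M T Y" ..
  note joint = joint_distr_indep_set[OF sub Y ind]
  have inner: "(\<integral>y. \<Psi> (w, y) \<partial>distr M T Y) = (\<integral>w'. \<Psi> (w, Y w') \<partial>M)"
    if [measurable]: "\<Psi> \<in> borel_measurable (F \<Otimes>\<^sub>M T)" and "w \<in> space M" for \<Psi> :: "_ \<Rightarrow> real" and w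
    using that by (intro integral_distr) (auto simp: sp)
  have meas: "(\<lambda>w. \<integral>y. \<Psi> (w, y) \<partial>distr M T Y) \<in> borel_measurable F"
    if [measurable]: "\<Psi> \<in> borel_measurable (F \<Otimes>\<^sub>M T)" for \<Psi> :: "_ \<Rightarrow> real"
    by (rule PY.borel_measurable_lebesgue_integral) simp
  have dec: "integrable M (\<lambda>w. \<integral>w'. \<Psi> (w, Y w') \<partial>M)"
    "(\<integral>w. \<Psi> (w, Y w) \<partial>M) = (\<integral>w. \<integral>w'. \<Psi> (w, Y w') \<partial>M \<partial>M)"
    if [measurable]: "\<Psi> \<in> borel_measurable (F \<Otimes>\<^sub>M T)"
      and int: "integrable M (\<lambda>w. \<Psi> (w, Y w))" for \<Psi> :: "_ \<Rightarrow> real"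
  proof -
    have int': "integrable (distr M F (\<lambda>w. w) \<Otimes>\<^sub>M distr M T Y) \<Psi>"
      unfolding joint using int by (simp add: integrable_distr_eq)
    have "integrable M (\<lambda>w. \<integral>y. \<Psi> (w, y) \<partial>distr M T Y)"
      using P.integrable_fst'[OF int'] integrable_distr_eq[OF id meas[OF that(1)]] by simp
    thus "integrable M (\<lambda>w. \<integral>w'. \<Psi> (w, Y w') \<partial>M)"
      using inner[OF that(1)] by (simp cong: Bochner_Integration.integrable_cong)
    have "(\<integral>w. \<Psi> (w, Y w) \<partial>M) = (\<integral>z. \<Psi> z \<partial>distr M (F \<Otimes>\<^sub>M T) (\<lambda>w. (w, Y w)))"
      by (simp add: integral_distr)
    also have "\<dots> = (\<integral>x. \<integral>y. \<Psi> (x, y) \<partial>distr M T Y \<partial>distr M F (\<lambda>w. w))"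
      unfolding joint[symmetric] by (rule P.integral_fst'[OF int', symmetric])
    also have "\<dots> = (\<integral>w. \<integral>y. \<Psi> (w, y) \<partial>distr M T Y \<partial>M)"
      by (rule integral_distr[OF id meas[OF that(1)]])
    also have "\<dots> = (\<integral>w. \<integral>w'. \<Psi> (w, Y w') \<partial>M \<partial>M)"
      by (intro Bochner_Integration.integral_cong refl inner that(1))
    finally show "(\<integral>w. \<Psi> (w, Y w) \<partial>M) = (\<integral>w. \<integral>w'. \<Psi> (w, Y w') \<partial>M \<partial>M)" .
  qed
  \<comment> \<open>The indicator of an event of the past is one more factor that the decoupling freezes.\<close>
  show ?thesis
  proof (rule real_cond_exp_charact)
    fix A assume A[measurable]: "A \<in> sets F"
    hence [measurable]: "A \<in> sets M" using sub by (auto simp: subalgebra_def)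
    have m: "(\<lambda>z. indicator A (fst z) * \<Phi> z) \<in> borel_measurable (F \<Otimes>\<^sub>M T)" by measurable
    have "integrable M (\<lambda>w. indicator A w *\<^sub>R \<Phi> (w, Y w))"
      by (rule integrable_mult_indicator[OF _ int]) simp
    hence "(\<integral>w. indicator A w * \<Phi> (w, Y w) \<partial>M) = (\<integral>w. \<integral>w'. indicator A w * \<Phi> (w, Y w') \<partial>M \<partial>M)"
      using dec(2)[OF m] by simp
    thus "(\<integral>w\<in>A. \<Phi> (w, Y w) \<partial>M) = (\<integral>w\<in>A. (\<integral>w'. \<Phi> (w, Y w') \<partial>M) \<partial>M)"
      by (simp add: set_lebesgue_integral_def)
  next
    show "integrable M (\<lambda>w. \<integral>w'. \<Phi> (w, Y w') \<partial>M)" by (rule dec(1)[OF \<Phi> int])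
    show "(\<lambda>w. \<integral>w'. \<Phi> (w, Y w') \<partial>M) \<in> borel_measurable F"
      using meas[OF \<Phi>] inner[OF \<Phi>] by (simp add: sp cong: measurable_cong)
  qed (rule int)
qed

text \<open>
  The summands \<open>H w (\<xi> j w)\<close> are independent only conditionally on the past, which they share through the
  first argument of \<open>H\<close>. Decoupling the past from the samples turns the conditional hypotheses into
  statements about almost every frozen past, to which \<open>indep_sum_powr_moment\<close> applies; integrating
  over the past gives the bound.
\<close>

lemma (in prob_space) conditional_sum_powr_moment:
  fixes H :: "'a \<Rightarrow> real \<Rightarrow> real" and \<xi> :: "nat \<Rightarrow> 'a \<Rightarrow> real"
  assumes p: "1 < p" "p \<le> 2" and \<nu>: "0 \<le> \<nu>" and sub: "subalgebra M F"
    and fin: "finite I" and indep: "indep_vars (\<lambda>_. borel) \<xi> I"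
    and fresh: "indep_set (sets F) (sets (vimage_algebra (space M) (\<lambda>w. \<lambda>j\<in>I. \<xi> j w) (Pi\<^sub>M I (\<lambda>_. borel))))"
    and H[measurable]: "(\<lambda>(w, z). H w z) \<in> borel_measurable (F \<Otimes>\<^sub>M borel)"
    and mean: "\<And>j. j \<in> I \<Longrightarrow> AE w in M. real_cond_exp M F (\<lambda>w. H w (\<xi> j w)) w = 0"
    and mom: "\<And>j. j \<in> I \<Longrightarrow>
      AE w in M. nn_cond_exp M F (\<lambda>w. ennreal (\<bar>H w (\<xi> j w)\<bar> powr p)) w \<le> ennreal (\<nu> powr p)"
    and A: "A \<subseteq> I"
  shows "(\<integral>\<^sup>+w. ennreal (\<bar>\<Sum>j\<in>A. H w (\<xi> j w)\<bar> powr p) \<partial>M) \<le> ennreal (3 * card A * \<nu> powr p)"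
proof -
  interpret F: finite_measure_subalgebra M F by unfold_locales (rule sub)
  let ?P = "Pi\<^sub>M I (\<lambda>_. borel) :: (nat \<Rightarrow> real) measure"
  let ?Y = "\<lambda>w. \<lambda>j\<in>I. \<xi> j w"
  have [measurable]: "(\<lambda>w. w) \<in> measurable M F"
    by (rule measurable_from_subalg[OF sub]) simp
  have \<xi>[measurable]: "\<xi> j \<in> borel_measurable M" if "j \<in> I" for j
    using indep that by (auto simp: indep_vars_def)
  have Y: "?Y \<in> measurable M ?P" by measurable
  have [measurable]: "(\<lambda>w. H w (\<xi> j w)) \<in> borel_measurable M" if "j \<in> I" for j
  proof -
    have "(\<lambda>w. (w, \<xi> j w)) \<in> measurable M (F \<Otimes>\<^sub>M borel)" using that by measurable
    from measurable_compose[OF this H] show ?thesis by simp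
  qed
  have coord: "(\<lambda>z. H (fst z) (snd z j)) \<in> borel_measurable (F \<Otimes>\<^sub>M ?P)" if "j \<in> I" for j
  proof -
    have "(\<lambda>z. (fst z, snd z j)) \<in> measurable (F \<Otimes>\<^sub>M ?P) (F \<Otimes>\<^sub>M borel)"
      using that by measurable
    from measurable_compose[OF this H] show ?thesis by simp
  qed
  have tot: "(\<integral>\<^sup>+w. ennreal (\<bar>H w (\<xi> j w)\<bar> powr p) \<partial>M) \<le> ennreal (\<nu> powr p)" if j: "j \<in> I" for j
  proof -
    have "(\<integral>\<^sup>+w. 1 * ennreal (\<bar>H w (\<xi> j w)\<bar> powr p) \<partial>M)
        = (\<integral>\<^sup>+w. 1 * nn_cond_exp M F (\<lambda>w. ennreal (\<bar>H w (\<xi> j w)\<bar> powr p)) w \<partial>M)"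
      using j by (intro F.nn_cond_exp_intg[symmetric]) auto
    also have "\<dots> \<le> (\<integral>\<^sup>+w. ennreal (\<nu> powr p) \<partial>M)"
      using mom[OF j] by (intro nn_integral_mono_AE) auto
    finally show ?thesis by (simp add: emeasure_space_1)
  qed
  \<comment> \<open>\<open>w\<close> is the past and \<open>w'\<close> an independent copy of it that only drives the fresh samples.\<close>
  have dec: "(\<integral>\<^sup>+w. \<integral>\<^sup>+w'. ennreal (\<bar>\<Sum>j\<in>B. H w (\<xi> j w')\<bar> powr p) \<partial>M \<partial>M)
      = (\<integral>\<^sup>+w. ennreal (\<bar>\<Sum>j\<in>B. H w (\<xi> j w)\<bar> powr p) \<partial>M)" if B: "B \<subseteq> I" for B
  proof -
    have m: "(\<lambda>z. ennreal (\<bar>\<Sum>j\<in>B. H (fst z) (snd z j)\<bar> powr p)) \<in> borel_measurable (F \<Otimes>\<^sub>M ?P)"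
    proof -
      have [measurable]: "(\<lambda>z. H (fst z) (snd z j)) \<in> borel_measurable (F \<Otimes>\<^sub>M ?P)" if "j \<in> B" for j
        using coord B that by auto
      show ?thesis by measurable
    qed
    have e: "(\<Sum>j\<in>B. H w (?Y w' j)) = (\<Sum>j\<in>B. H w (\<xi> j w'))" for w w'
      using B by (intro sum.cong) auto
    show ?thesis
      using nn_integral_decouple[OF sub Y fresh m, symmetric] unfolding fst_conv snd_conv e .
  qed
  have meas1: "(\<lambda>w. \<integral>\<^sup>+w'. ennreal (\<bar>H w (\<xi> j w')\<bar> powr p) \<partial>M) \<in> borel_measurable M" if j: "j \<in> I" for j
  proof -
    have "(\<lambda>z. (fst z, \<xi> j (snd z))) \<in> measurable (M \<Otimes>\<^sub>M M) (F \<Otimes>\<^sub>M borel)"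
      using j by (intro measurable_Pair measurable_compose[OF measurable_fst] measurable_compose[OF measurable_snd]) auto
    from measurable_compose[OF this H] have "(\<lambda>(w, w'). ennreal (\<bar>H w (\<xi> j w')\<bar> powr p)) \<in> borel_measurable (M \<Otimes>\<^sub>M M)"
      by (simp add: case_prod_beta)
    thus ?thesis by (rule borel_measurable_nn_integral)
  qed
  have finite_moment: "AE w in M. integrable M (\<lambda>w'. \<bar>H w (\<xi> j w')\<bar> powr p)" if j: "j \<in> I" for j
  proof -
    have "(\<integral>\<^sup>+w. \<integral>\<^sup>+w'. ennreal (\<bar>H w (\<xi> j w')\<bar> powr p) \<partial>M \<partial>M) \<le> ennreal (\<nu> powr p)"
      using dec[of "{j}"] tot[OF j] j by simp
    also have "\<dots> < \<infinity>" by simp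
    finally have ne: "(\<integral>\<^sup>+w. \<integral>\<^sup>+w'. ennreal (\<bar>H w (\<xi> j w')\<bar> powr p) \<partial>M \<partial>M) \<noteq> \<infinity>" by simp
    from nn_integral_PInf_AE[OF meas1[OF j] ne] show ?thesis
    proof (rule AE_mp, intro AE_I2 impI)
      fix w assume w: "w \<in> space M" and fin: "(\<integral>\<^sup>+w'. ennreal (\<bar>H w (\<xi> j w')\<bar> powr p) \<partial>M) \<noteq> \<infinity>"
      have "w \<in> space F" using w sub by (simp add: subalgebra_def)
      hence "H w \<in> borel_measurable borel" using H by (auto intro: measurable_Pair2[where f = "\<lambda>(w,z). H w z", simplified])
      hence "(\<lambda>w'. H w (\<xi> j w')) \<in> borel_measurable M" using measurable_compose[OF \<xi>[OF j]] by blast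
      thus "integrable M (\<lambda>w'. \<bar>H w (\<xi> j w')\<bar> powr p)"
        using fin by (intro integrableI_nonneg) (auto simp: top.not_eq_extremum)
    qed
  qed
  have int: "integrable M (\<lambda>w. H w (\<xi> j w))" if j: "j \<in> I" for j
  proof -
    have "integrable M (\<lambda>w. \<bar>H w (\<xi> j w)\<bar> powr p)"
      using tot[OF j] j by (intro integrableI_nonneg) (auto intro: le_less_trans)
    from integrable_of_powr_moment[OF _ _ this] show ?thesis using p j by simp
  qed
  have centred: "AE w in M. expectation (\<lambda>w'. H w (\<xi> j w')) = 0" if j: "j \<in> I" for j
  proof -
    have "AE w in M. real_cond_exp M F (\<lambda>w. H w (\<xi> j w)) w = expectation (\<lambda>w'. H w (\<xi> j w'))"
      using real_cond_exp_decouple[OF sub Y fresh coord[OF j]] j int[OF j] by simp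
    with mean[OF j] show ?thesis by eventually_elim simp
  qed
  have "AE w in M. \<forall>j\<in>I. integrable M (\<lambda>w'. \<bar>H w (\<xi> j w')\<bar> powr p) \<and> expectation (\<lambda>w'. H w (\<xi> j w')) = 0"
    using finite_moment centred fin by (intro AE_finite_allI) auto
  \<comment> \<open>Once the past is frozen at \<open>w\<close>, the summands are independent and centred.\<close>
  hence bound: "AE w in M. (\<integral>\<^sup>+w'. ennreal (\<bar>\<Sum>j\<in>A. H w (\<xi> j w')\<bar> powr p) \<partial>M)
      \<le> (\<Sum>j\<in>A. 3 * (\<integral>\<^sup>+w'. ennreal (\<bar>H w (\<xi> j w')\<bar> powr p) \<partial>M))"
  proof (rule AE_mp, intro AE_I2 impI)
    fix w assume w: "w \<in> space M"
      and good: "\<forall>j\<in>I. integrable M (\<lambda>w'. \<bar>H w (\<xi> j w')\<bar> powr p) \<and> expectation (\<lambda>w'. H w (\<xi> j w')) = 0"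
    have "w \<in> space F" using w sub by (simp add: subalgebra_def)
    hence Hw[measurable]: "H w \<in> borel_measurable borel" using H by (auto intro: measurable_Pair2[where f = "\<lambda>(w,z). H w z", simplified])
    have ind: "indep_vars (\<lambda>_. borel) (\<lambda>j w'. H w (\<xi> j w')) A"
      using indep_vars_compose2[OF indep_vars_subset[OF indep A], of "\<lambda>_. H w" "\<lambda>_. borel"] by simp
    have fA: "finite A" using A fin finite_subset by auto
    have vbe: "integrable M (\<lambda>w'. \<bar>\<Sum>j\<in>A. H w (\<xi> j w')\<bar> powr p)"
      "expectation (\<lambda>w'. \<bar>\<Sum>j\<in>A. H w (\<xi> j w')\<bar> powr p) \<le> 3 * (\<Sum>j\<in>A. expectation (\<lambda>w'. \<bar>H w (\<xi> j w')\<bar> powr p))"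
      using indep_sum_powr_moment[OF p fA ind] good A by auto
    have "(\<integral>\<^sup>+w'. ennreal (\<bar>\<Sum>j\<in>A. H w (\<xi> j w')\<bar> powr p) \<partial>M)
        = ennreal (expectation (\<lambda>w'. \<bar>\<Sum>j\<in>A. H w (\<xi> j w')\<bar> powr p))"
      using vbe(1) by (intro nn_integral_eq_integral) auto
    also have "\<dots> \<le> ennreal (\<Sum>j\<in>A. 3 * expectation (\<lambda>w'. \<bar>H w (\<xi> j w')\<bar> powr p))"
      using vbe(2) by (intro ennreal_leI) (simp add: sum_distrib_left)
    also have "\<dots> = (\<Sum>j\<in>A. 3 * ennreal (expectation (\<lambda>w'. \<bar>H w (\<xi> j w')\<bar> powr p)))"
      by (subst sum_ennreal[symmetric]) (auto simp: ennreal_mult)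
    also have "\<dots> = (\<Sum>j\<in>A. 3 * (\<integral>\<^sup>+w'. ennreal (\<bar>H w (\<xi> j w')\<bar> powr p) \<partial>M))"
      using good A by (intro sum.cong refl arg_cong[where f = "(*) 3"] nn_integral_eq_integral[symmetric]) auto
    finally show "(\<integral>\<^sup>+w'. ennreal (\<bar>\<Sum>j\<in>A. H w (\<xi> j w')\<bar> powr p) \<partial>M)
      \<le> (\<Sum>j\<in>A. 3 * (\<integral>\<^sup>+w'. ennreal (\<bar>H w (\<xi> j w')\<bar> powr p) \<partial>M))" .
  qed
  have "(\<integral>\<^sup>+w. ennreal (\<bar>\<Sum>j\<in>A. H w (\<xi> j w)\<bar> powr p) \<partial>M)
      = (\<integral>\<^sup>+w. \<integral>\<^sup>+w'. ennreal (\<bar>\<Sum>j\<in>A. H w (\<xi> j w')\<bar> powr p) \<partial>M \<partial>M)"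
    using dec[OF A] by simp
  also have "\<dots> \<le> (\<integral>\<^sup>+w. (\<Sum>j\<in>A. 3 * (\<integral>\<^sup>+w'. ennreal (\<bar>H w (\<xi> j w')\<bar> powr p) \<partial>M)) \<partial>M)"
    by (rule nn_integral_mono_AE[OF bound])
  also have "\<dots> = (\<Sum>j\<in>A. 3 * (\<integral>\<^sup>+w. \<integral>\<^sup>+w'. ennreal (\<bar>H w (\<xi> j w')\<bar> powr p) \<partial>M \<partial>M))"
    using meas1 A by (subst nn_integral_sum) (auto intro!: sum.cong nn_integral_cmult)
  also have "\<dots> \<le> (\<Sum>j\<in>A. 3 * ennreal (\<nu> powr p))"
    using dec[of "{_}"] tot A by (intro sum_mono mult_left_mono) (auto simp: subset_iff)
  also have "\<dots> = ennreal (3 * card A * \<nu> powr p)"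
    by (simp add: ennreal_mult ennreal_of_nat_eq_real_of_nat mult_ac)
  finally show ?thesis .
qed

lemma (in prob_space) AE_tendsto_zero_of_summable_moments:
  fixes W :: "nat \<Rightarrow> 'a \<Rightarrow> real"
  assumes [measurable]: "\<And>k. W k \<in> borel_measurable M" and W: "\<And>k w. 0 \<le> W k w"
    and q: "\<And>k. (\<integral>\<^sup>+w. ennreal (W k w) \<partial>M) \<le> ennreal (q k)" "\<And>k. 0 \<le> q k" "summable q"
  shows "AE w in M. (\<lambda>k. W k w) \<longlonglongrightarrow> 0"
proof -
  have "(\<integral>\<^sup>+w. (\<Sum>k. ennreal (W k w)) \<partial>M) = (\<Sum>k. \<integral>\<^sup>+w. ennreal (W k w) \<partial>M)"
    by (rule nn_integral_suminf) simp
  also have "\<dots> \<le> (\<Sum>k. ennreal (q k))" by (intro suminf_le q(1)) auto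
  also have "\<dots> = ennreal (\<Sum>k. q k)" using q by (intro suminf_ennreal2)
  also have "\<dots> < \<infinity>" by simp
  finally have "(\<integral>\<^sup>+w. (\<Sum>k. ennreal (W k w)) \<partial>M) \<noteq> \<infinity>" by simp
  hence "AE w in M. (\<Sum>k. ennreal (W k w)) \<noteq> \<infinity>" by (intro nn_integral_PInf_AE) auto
  thus ?thesis
  proof eventually_elim
    case (elim w)
    hence "summable (\<lambda>k. W k w)" using W by (intro summable_suminf_not_top) auto
    thus ?case by (rule summable_LIMSEQ_zero)
  qed
qed

section \<open>The corrected median-of-means estimate\<close>

text \<open>
  Expresses order statistics by counting entries, which reduces their measurability to that of the
  entries.
\<close>

lemma sort_nth_le_iff:
  fixes xs :: "'a::linorder list"
  assumes "i < length xs"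
  shows "sort xs ! i \<le> t \<longleftrightarrow> i < card {j. j < length xs \<and> xs ! j \<le> t}"
proof -
  define ys where "ys = sort xs"
  have s: "sorted ys" "i < length ys" using assms by (auto simp: ys_def)
  have "card {j. j < length xs \<and> xs ! j \<le> t} = length (filter (\<lambda>x. x \<le> t) xs)"
    by (simp add: length_filter_conv_card)
  also have "\<dots> = length (filter (\<lambda>x. x \<le> t) ys)"
    unfolding ys_def by (metis mset_filter mset_sort size_mset)
  also have "\<dots> = card {j. j < length ys \<and> ys ! j \<le> t}"
    by (simp add: length_filter_conv_card)
  finally have c: "card {j. j < length xs \<and> xs ! j \<le> t} = card {j. j < length ys \<and> ys ! j \<le> t}" .
  have "i < card {j. j < length ys \<and> ys ! j \<le> t}" if "ys ! i \<le> t"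
  proof -
    have "{..i} \<subseteq> {j. j < length ys \<and> ys ! j \<le> t}"
      using s that by (auto intro: order_trans[OF sorted_nth_mono])
    from card_mono[OF _ this] show ?thesis by simp
  qed
  moreover have "ys ! i \<le> t" if "i < card {j. j < length ys \<and> ys ! j \<le> t}"
  proof (rule ccontr)
    assume "\<not> ys ! i \<le> t"
    hence "{j. j < length ys \<and> ys ! j \<le> t} \<subseteq> {..<i}"
      using s by (auto simp: not_le) (meson leD leI order_trans sorted_nth_mono)
    from card_mono[OF _ this] that show False by simp
  qed
  ultimately show ?thesis unfolding c ys_def by blast
qed

lemma borel_measurable_sort_nth:
  fixes f :: "'b \<Rightarrow> 'a \<Rightarrow> real"
  assumes "\<And>l. l \<in> set ls \<Longrightarrow> f l \<in> borel_measurable N" and i: "i < length ls"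
  shows "(\<lambda>w. sort (map (\<lambda>l. f l w) ls) ! i) \<in> borel_measurable N"
proof (subst borel_measurable_iff_le, rule allI)
  fix t
  have [measurable]: "f (ls ! j) \<in> borel_measurable N" if "j < length ls" for j
    using assms that by simp
  have "(\<lambda>w. \<Sum>j<length ls. if f (ls ! j) w \<le> t then 1 else (0::nat)) \<in> measurable N (count_space UNIV)"
    by measurable
  moreover have "(\<Sum>j<length ls. if f (ls ! j) w \<le> t then 1 else (0::nat))
      = card {j. j < length ls \<and> f (ls ! j) w \<le> t}" for w
    by (simp add: sum.If_cases lessThan_def Collect_conj_eq)
  ultimately have [measurable]: "(\<lambda>w. card {j. j < length ls \<and> f (ls ! j) w \<le> t}) \<in> measurable N (count_space UNIV)"
    by simp
  have "{w \<in> space N. sort (map (\<lambda>l. f l w) ls) ! i \<le> t} =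
      {w \<in> space N. i < card {j. j < length ls \<and> f (ls ! j) w \<le> t}}"
    using i by (auto simp: sort_nth_le_iff cong: conj_cong)
  also have "\<dots> \<in> sets N" by measurable
  finally show "{w \<in> space N. sort (map (\<lambda>l. f l w) ls) ! i \<le> t} \<in> sets N" .
qed

lemma borel_measurable_median:
  fixes f :: "'b \<Rightarrow> 'a \<Rightarrow> real"
  assumes "\<And>l. l \<in> set ls \<Longrightarrow> f l \<in> borel_measurable N" and "ls \<noteq> []"
  shows "(\<lambda>w. median (map (\<lambda>l. f l w) ls)) \<in> borel_measurable N"
proof -
  have "0 < length ls" using assms(2) by simp
  hence "length ls div 2 < length ls" "length ls div 2 - 1 < length ls" by linarith+
  note [measurable] = this[THEN borel_measurable_sort_nth[where f = f and N = N, rotated], OF assms(1)]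
  show ?thesis unfolding median_def Let_def length_map by measurable
qed

lemma borel_measurable_corrected_estimate:
  assumes "1 \<le> b" and "\<And>l j. l \<in> {1..b} \<Longrightarrow> j \<in> B l \<Longrightarrow> (\<lambda>w. g w j) \<in> borel_measurable N"
  shows "(\<lambda>w. corrected_estimate \<eta> b s B (g w)) \<in> borel_measurable N"
proof -
  have bm: "(\<lambda>w. block_mean s B (g w) l) \<in> borel_measurable N" if "l \<in> {1..b}" for l
    unfolding block_mean_def using assms(2)[OF that] by (intro borel_measurable_times borel_measurable_sum) auto
  have "(\<lambda>w. median (map (\<lambda>l. block_mean s B (g w) l) [1..<Suc b])) \<in> borel_measurable N"
    using assms(1) by (intro borel_measurable_median bm) auto
  moreover have "(\<lambda>w. \<Sum>l=1..b. block_mean s B (g w) l) \<in> borel_measurable N"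
    by (intro borel_measurable_sum bm)
  ultimately show ?thesis
    unfolding corrected_estimate_def median_of_means_def mean_of_means_def by measurable
qed

lemma median_deviation_le:
  assumes "xs \<noteq> []" and "\<And>x. x \<in> set xs \<Longrightarrow> \<bar>x - v\<bar> \<le> r"
  shows "\<bar>median xs - v\<bar> \<le> r"
proof -
  have *: "\<bar>sort xs ! i - v\<bar> \<le> r" if "i < length xs" for i
    using assms(2)[of "sort xs ! i"] that by (metis length_sort nth_mem set_sort)
  have "0 < length xs" using assms(1) by simp
  hence "length xs div 2 < length xs" "length xs div 2 - 1 < length xs" by linarith+
  from this[THEN *] show ?thesis unfolding median_def Let_def by (auto simp: abs_le_iff field_simps)
qed

text \<open>
  The median is an entry of the list of block means, or the midpoint of two entries; the mean and the
  correction are convex combinations. None of these leaves the interval of radius \<open>r\<close> about \<open>v\<close>.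
\<close>

lemma corrected_estimate_deviation_le:
  assumes "0 \<le> \<eta>" "\<eta> \<le> 1" "1 \<le> b"
    and "\<And>l. l \<in> {1..b} \<Longrightarrow> \<bar>block_mean s B g l - v\<bar> \<le> r"
  shows "\<bar>corrected_estimate \<eta> b s B g - v\<bar> \<le> r"
proof -
  have 1: "\<bar>median_of_means b s B g - v\<bar> \<le> r"
    unfolding median_of_means_def using assms by (intro median_deviation_le) auto
  have "mean_of_means b s B g - v = (1 / real b) * (\<Sum>l=1..b. block_mean s B g l - v)"
    using assms(3) by (simp add: mean_of_means_def sum_subtractf field_simps)
  also have "\<bar>\<dots>\<bar> \<le> (1 / real b) * (\<Sum>l=1..b. \<bar>block_mean s B g l - v\<bar>)"
    by (simp add: abs_mult divide_right_mono sum_abs)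
  also have "\<dots> \<le> (1 / real b) * (\<Sum>l=1..b. r)" using assms by (intro mult_left_mono sum_mono) auto
  also have "\<dots> = r" using assms(3) by simp
  finally have 2: "\<bar>mean_of_means b s B g - v\<bar> \<le> r" .
  have "corrected_estimate \<eta> b s B g - v
      = (1 - \<eta>) * (median_of_means b s B g - v) + \<eta> * (mean_of_means b s B g - v)"
    by (simp add: corrected_estimate_def algebra_simps)
  also have "\<bar>\<dots>\<bar> \<le> (1 - \<eta>) * \<bar>median_of_means b s B g - v\<bar> + \<eta> * \<bar>mean_of_means b s B g - v\<bar>"
    using assms(1,2) by (intro order_trans[OF abs_triangle_ineq]) (simp add: abs_mult)
  also have "\<dots> \<le> (1 - \<eta>) * r + \<eta> * r" using 1 2 assms(1,2) by (intro add_mono mult_left_mono) auto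
  finally show ?thesis by (simp add: algebra_simps)
qed

section \<open>Growth of the block parameters\<close>

text \<open>
  With \<open>\<gamma> = (k + 1) powr (- 2)\<close> the logarithm in the number of blocks is \<open>l = 1 + 16 ln (k + 1)\<close>. Hence there are at
  most \<open>l\<close> blocks, and since rounding loses at most half of the samples, each has size at least
  \<open>m / (2 l)\<close>.
\<close>

lemma block_parameters_bound:
  assumes m: "real (k + 1) powr \<beta> \<le> real m" "1 \<le> m" and \<delta>: "1 < \<delta>" "\<delta> \<le> 2"
  defines "n \<equiv> block_count m (1 / (real (k + 1))\<^sup>2)"
    and "s \<equiv> block_size m (1 / (real (k + 1))\<^sup>2)"
  shows "1 \<le> n" "1 \<le> s"
    "real n * real s powr (1 - \<delta>) \<le> 2 * (1 + 16 * ln (real (k + 1)))\<^sup>2 * real (k + 1) powr (- (\<beta> * (\<delta> - 1)))"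
proof -
  define r where "r = raw_block_count m (1 / (real (k + 1))\<^sup>2)"
  define l where "l = 1 + 16 * ln (real (k + 1))"
  have l1: "1 \<le> l" by (simp add: l_def)
  have "8 * ln (exp (1 / 8) * inverse (1 / (real (k + 1))\<^sup>2)) = l"
    by (simp add: l_def ln_mult ln_realpow divide_simps del: of_nat_Suc of_nat_add)
  hence r: "r = nat \<lfloor>min l (real m / 2)\<rfloor>" unfolding r_def raw_block_count_def by simp
  have rl: "real r \<le> min l (real m / 2)" unfolding r using l1 by (intro of_nat_floor) simp
  have ns: "n = (if r = 0 then 1 else r)" "s = (if r = 0 then 1 else m div r)"
    by (simp_all add: n_def s_def block_count_def block_size_def r_def)
  show n1: "1 \<le> n" by (simp add: ns)
  have nl: "real n \<le> l" using rl l1 by (simp add: ns)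
  have ms: "real m \<le> 2 * real n * real s"
  proof (cases "r = 0")
    case True
    hence "min l (real m / 2) < 1" unfolding r using l1 by linarith
    thus ?thesis using True l1 by (simp add: ns)
  next
    case False
    have "2 * r \<le> m" using rl by linarith
    hence "r \<le> r * (m div r)" using False by (simp add: Suc_le_eq div_greater_zero_iff)
    moreover have "m < r * (m div r) + r" using False
      by (metis add.commute add_less_cancel_left mod_less_divisor mult.commute neq0_conv div_mult_mod_eq)
    ultimately have "m \<le> 2 * (r * (m div r))" by linarith
    hence "real m \<le> real (2 * (r * (m div r)))" using of_nat_le_iff by blast
    thus ?thesis using False by (simp add: ns mult.assoc)
  qed
  show s1: "1 \<le> s"
  proof -
    have "s \<noteq> 0" using ms m(2) by (cases "s = 0") auto
    thus ?thesis by simp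
  qed
  have "real (k + 1) powr \<beta> \<le> 2 * l * real s"
    using m(1) ms nl by (meson mult_left_mono mult_right_mono of_nat_0_le_iff order_trans zero_le_numeral)
  hence "(real (k + 1) powr \<beta>) powr (\<delta> - 1) \<le> (2 * l * real s) powr (\<delta> - 1)"
    using \<delta> by (intro powr_mono2) auto
  also have "\<dots> = (2 * l) powr (\<delta> - 1) * real s powr (\<delta> - 1)" using l1 by (simp add: powr_mult)
  also have "\<dots> \<le> (2 * l) * real s powr (\<delta> - 1)"
    using powr_mono[of "\<delta> - 1" 1 "2 * l"] l1 \<delta> by (intro mult_right_mono) auto
  finally have "real (k + 1) powr (\<beta> * (\<delta> - 1)) \<le> 2 * l * real s powr (\<delta> - 1)" by (simp only: powr_powr)
  hence "real s powr (1 - \<delta>) \<le> 2 * l * real (k + 1) powr (- (\<beta> * (\<delta> - 1)))"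
  proof -
    have e: "1 - \<delta> = - (\<delta> - 1)" by simp
    have "0 < real s powr (\<delta> - 1)" "0 < real (k + 1) powr (\<beta> * (\<delta> - 1))" using s1 by auto
    thus ?thesis using \<open>real (k + 1) powr (\<beta> * (\<delta> - 1)) \<le> 2 * l * real s powr (\<delta> - 1)\<close>
      unfolding e powr_minus by (simp add: field_simps del: of_nat_Suc of_nat_add)
  qed
  hence "real n * real s powr (1 - \<delta>) \<le> l * (2 * l * real (k + 1) powr (- (\<beta> * (\<delta> - 1))))"
    using nl l1 by (intro mult_mono) auto
  thus "real n * real s powr (1 - \<delta>) \<le> 2 * (1 + 16 * ln (real (k + 1)))\<^sup>2 * real (k + 1) powr (- (\<beta> * (\<delta> - 1)))"
    unfolding l_def power2_eq_square by (simp only: mult_ac)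
qed

text \<open>
  The logarithms are absorbed into a part of the margin between \<open>p\<close> and \<open>1\<close>.
\<close>

lemma summable_log_powr:
  assumes "1 < (p::real)"
  shows "summable (\<lambda>k. (1 + 16 * ln (real (k + 1)))\<^sup>2 * real (k + 1) powr (- p))"
proof (rule summable_comparison_test_bigo)
  define q where "q = (1 + p) / 2"
  have q: "1 < q" "q < p" using assms by (auto simp: q_def field_simps)
  show "summable (\<lambda>k. norm (real k powr (- q)))" using q by (simp add: summable_real_powr_iff)
  show "(\<lambda>k. (1 + 16 * ln (real (k + 1)))\<^sup>2 * real (k + 1) powr (- p)) \<in> O(\<lambda>k. real k powr (- q))"
    using q by real_asymp
qed

section \<open>The history filtration\<close>

lemma history_space_sets:
  "space (history M X0 \<xi> m k) = space M"
  "sets (history M X0 \<xi> m k) = sigma_sets (space M)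
     ({X0 -` A \<inter> space M | A. A \<in> sets borel} \<union>
      {\<xi> i k' j -` A \<inter> space M | i k' j A. k' < k \<and> j \<in> {1..m k'} \<and> A \<in> sets borel})"
  unfolding history_def by (subst space_measure_of_conv sets_measure_of; auto)+

lemma subalgebra_history:
  assumes X0: "X0 \<in> borel_measurable M"
    and \<xi>: "\<And>i k j. j \<in> {1..m k} \<Longrightarrow> \<xi> i k j \<in> borel_measurable M"
  shows "subalgebra M (history M X0 \<xi> m k)"
  unfolding subalgebra_def history_space_sets
  using measurable_sets[OF X0] measurable_sets[OF \<xi>]
  by (auto intro!: sets.sigma_sets_subset)

lemma sets_history_mono:
  assumes "k \<le> k'"
  shows "sets (history M X0 \<xi> m k) \<subseteq> sets (history M X0 \<xi> m k')"
  unfolding history_space_sets using assms by (intro sigma_sets_mono') fastforce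

lemma measurable_history_initial: "X0 \<in> borel_measurable (history M X0 \<xi> m k)"
  by (intro measurableI) (auto simp: history_space_sets intro!: sigma_sets.Basic)

lemma measurable_history_sample:
  assumes "k' < k" "j \<in> {1..m k'}"
  shows "\<xi> i k' j \<in> borel_measurable (history M X0 \<xi> m k)"
proof (rule measurableI)
  fix A :: "real set" assume "A \<in> sets borel"
  thus "\<xi> i k' j -` A \<inter> space (history M X0 \<xi> m k) \<in> sets (history M X0 \<xi> m k)"
    unfolding history_space_sets using assms by (intro sigma_sets.Basic) blast
qed simp

section \<open>Almost sure convergence\<close>

theorem theorem3:
  fixes \<Omega> :: "'n::finite \<Rightarrow> real set"
    and U :: "(real ^ 'n) set"
    and f :: "'n \<Rightarrow> real ^ 'n \<Rightarrow> real \<Rightarrow> real"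
    and D :: "'n \<Rightarrow> real measure"
    and J :: "'n \<Rightarrow> real ^ 'n \<Rightarrow> real"
    and M :: "'w measure"
    and \<xi> :: "'n \<Rightarrow> nat \<Rightarrow> nat \<Rightarrow> 'w \<Rightarrow> real"
    and X :: "nat \<Rightarrow> 'w \<Rightarrow> real ^ 'n"
    and \<F> :: "nat \<Rightarrow> 'w measure"
    and g \<epsilon> :: "'n \<Rightarrow> nat \<Rightarrow> nat \<Rightarrow> 'w \<Rightarrow> real"
    and B :: "'n \<Rightarrow> nat \<Rightarrow> nat \<Rightarrow> nat set"
    and m nb s :: "nat \<Rightarrow> nat"
    and \<alpha> \<gamma> \<eta> :: "nat \<Rightarrow> real"
    and c :: nat
    and a b \<beta> \<delta> \<nu> \<mu> L \<eta>\<^sub>0 \<rho> :: real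
  assumes players: "CARD('n) > 1"
    and U: "open U" "profiles \<Omega> \<subseteq> U"
    and D: "\<And>i. real_distribution (D i)"
    and f_integrable: "\<And>i x. x \<in> U \<Longrightarrow> integrable (D i) (f i x)"
    and f_differentiable: "\<And>i x. x \<in> profiles \<Omega> \<Longrightarrow>
          AE z in D i. (\<lambda>t. f i (set_coord x i t) z) differentiable (at (x $ i))"
    and f_measurable: "\<And>i. (\<lambda>(x, z). partial_deriv i (\<lambda>y. f i y z) x)
          \<in> borel_measurable (restrict_space borel (profiles \<Omega>) \<Otimes>\<^sub>M borel)"
    and J: "\<And>i x. J i x = (LINT z|D i. f i x z)"
    and \<Omega>: "profiles \<Omega> \<noteq> {}" "convex (profiles \<Omega>)" "compact (profiles \<Omega>)"
    and J_C1: "\<And>i. continuously_differentiable_on (J i) U"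
    and J_convex: "\<And>i x. x \<in> profiles \<Omega> \<Longrightarrow> convex_on (\<Omega> i) (\<lambda>t. J i (set_coord x i t))"
    and \<mu>: "\<mu> > 0"
    and strongly_monotone: "\<And>x y. x \<in> profiles \<Omega> \<Longrightarrow> y \<in> profiles \<Omega> \<Longrightarrow>
          (pseudo_gradient J x - pseudo_gradient J y) \<bullet> (x - y) \<ge> \<mu> * (norm (x - y))\<^sup>2"
    and L: "L > 0"
    and lipschitz: "L-lipschitz_on (profiles \<Omega>) (pseudo_gradient J)"
    and \<delta>: "1 < \<delta>" "\<delta> \<le> 2"
    and a: "0 < a" "a \<le> 1" and b: "b > 0"
    and \<beta>: "\<beta> > 1 / (\<delta> - 1)" and c: "c \<ge> 1"
    and \<eta>\<^sub>0: "\<eta>\<^sub>0 > 0" and \<rho>: "\<rho> > 0"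
    and \<alpha>: "\<And>k. \<alpha> k = b * real (k + 1) powr (- a)"
    and m: "\<And>k. m k = c * nat \<lceil>real (k + 1) powr \<beta>\<rceil>"
    and \<gamma>: "\<And>k. \<gamma> k = 1 / (real (k + 1))\<^sup>2"
    and nb: "\<And>k. nb k = block_count (m k) (\<gamma> k)"
    and s: "\<And>k. s k = block_size (m k) (\<gamma> k)"
    and \<eta>: "\<And>k. \<eta> k = \<eta>\<^sub>0 * real (k + 1) powr (- \<rho>)"
    and \<eta>_range: "\<And>k. \<eta> k \<in> {0..1}"
    and B: "\<And>i k l. l \<in> {1..nb k} \<Longrightarrow> B i k l \<subseteq> {1..m k} \<and> card (B i k l) = s k"
      "\<And>i k. disjoint_family_on (B i k) {1..nb k}"
    and M: "prob_space M"
    and X0: "X 0 \<in> borel_measurable M" "\<And>\<omega>. \<omega> \<in> space M \<Longrightarrow> X 0 \<omega> \<in> profiles \<Omega>"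
    and \<F>: "\<And>k. \<F> k = history M (X 0) \<xi> m k"
    and samples_indep: "\<And>i k. prob_space.indep_vars M (\<lambda>_. borel) (\<xi> i k) {1..m k}"
    and samples_distr: "\<And>i k j. j \<in> {1..m k} \<Longrightarrow> distr M borel (\<xi> i k j) = D i"
    and samples_fresh: "\<And>i k. prob_space.indep_set M (sets (\<F> k))
          (sets (vimage_algebra (space M) (\<lambda>\<omega>. \<lambda>j\<in>{1..m k}. \<xi> i k j \<omega>)
                   (Pi\<^sub>M {1..m k} (\<lambda>_. borel))))"
    and g: "\<And>i k j \<omega>. g i k j \<omega> = partial_deriv i (\<lambda>x. f i x (\<xi> i k j \<omega>)) (X k \<omega>)"
    and step: "\<And>i k \<omega>. \<omega> \<in> space M \<Longrightarrow>
          X (Suc k) \<omega> $ i = closest_point (\<Omega> i)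
            (X k \<omega> $ i - \<alpha> k * corrected_estimate (\<eta> k) (nb k) (s k) (B i k) (\<lambda>j. g i k j \<omega>))"
    and \<epsilon>: "\<And>i k j \<omega>. \<epsilon> i k j \<omega> = g i k j \<omega> - partial_deriv i (J i) (X k \<omega>)"
    and unbiased: "\<And>i k j. j \<in> {1..m k} \<Longrightarrow>
          AE \<omega> in M. real_cond_exp M (\<F> k) (\<epsilon> i k j) \<omega> = 0"
    and \<nu>: "\<nu> > 0"
    and moment: "\<And>i k j. j \<in> {1..m k} \<Longrightarrow>
          AE \<omega> in M. nn_cond_exp M (\<F> k) (\<lambda>\<omega>. ennreal (\<bar>\<epsilon> i k j \<omega>\<bar> powr \<delta>)) \<omega> \<le> ennreal (\<nu> powr \<delta>)"
  shows "\<exists>x. (\<forall>y. nash_equilibrium \<Omega> J y \<longleftrightarrow> y = x) \<and>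
             (AE \<omega> in M. (\<lambda>k. norm (X k \<omega> - x)) \<longlonglongrightarrow> 0)"
proof -
  interpret prob_space M by (rule M)
  let ?P = "profiles \<Omega>" and ?F = "pseudo_gradient J"
  note co = profiles_coordinate[OF \<Omega>]
  have contF: "continuous_on ?P ?F" by (rule lipschitz_on_continuous_on[OF lipschitz])
  obtain y where y: "y \<in> ?P" "\<And>i t. t \<in> \<Omega> i \<Longrightarrow> 0 \<le> ?F y $ i * (t - y $ i)"
    using variational_solution_exists[OF \<Omega> contF] by blast
  note nash = nash_equilibrium_iff_variational[OF U(2) co(2) J_C1 J_convex]
  have unique: "nash_equilibrium \<Omega> J z \<longleftrightarrow> z = y" for z
  proof
    assume "nash_equilibrium \<Omega> J z"
    hence z: "z \<in> ?P" "\<And>i t. t \<in> \<Omega> i \<Longrightarrow> 0 \<le> ?F z $ i * (t - z $ i)" by (auto simp: nash)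
    show "z = y" by (rule variational_solution_unique[OF strongly_monotone[OF z(1) y(1)] \<mu> z y])
  qed (use y in \<open>simp add: nash\<close>)

  have m1: "1 \<le> m k" and m_ge: "real (k + 1) powr \<beta> \<le> real (m k)" for k
  proof -
    have \<beta>0: "0 \<le> \<beta>" using \<beta> \<delta> by (smt (verit) divide_nonneg_nonneg)
    have "1 \<le> real (k + 1) powr \<beta>" using \<beta>0 by (intro ge_one_powr_ge_zero) auto
    moreover have r: "real (k + 1) powr \<beta> \<le> real (nat \<lceil>real (k + 1) powr \<beta>\<rceil>)" by (rule real_nat_ceiling_ge)
    moreover have "nat \<lceil>real (k + 1) powr \<beta>\<rceil> \<le> m k"
      unfolding m using mult_le_mono1[OF c, of "nat \<lceil>real (k + 1) powr \<beta>\<rceil>"] by linarith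
    ultimately have "1 \<le> real (m k)" "real (k + 1) powr \<beta> \<le> real (m k)"
      by (meson of_nat_le_iff order_trans)+
    thus "1 \<le> m k" "real (k + 1) powr \<beta> \<le> real (m k)" by simp_all
  qed
  have nb1: "1 \<le> nb k" and s1: "1 \<le> s k"
    and nb_s: "real (nb k) * real (s k) powr (1 - \<delta>)
        \<le> 2 * (1 + 16 * ln (real (k + 1)))\<^sup>2 * real (k + 1) powr (- (\<beta> * (\<delta> - 1)))" for k
    using block_parameters_bound[OF m_ge m1 \<delta>, of k] unfolding nb s \<gamma> by blast+

  have \<xi>_meas: "\<xi> i k j \<in> borel_measurable M" if "j \<in> {1..m k}" for i k j
    using samples_indep[of i k] that by (auto simp: indep_vars_def)
  have sub: "subalgebra M (\<F> k)" for k
    unfolding \<F> by (rule subalgebra_history[OF X0(1) \<xi>_meas])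
  have spF: "space (\<F> k) = space M" for k unfolding \<F> by (rule history_space_sets)
  have X_in: "X k \<omega> \<in> ?P" if "\<omega> \<in> space M" for k \<omega>
  proof (cases k)
    case (Suc k')
    thus ?thesis using step[OF that] closest_point_in_set[OF co(3,1)] by (simp add: profiles_def)
  qed (use X0(2)[OF that] in simp)
  let ?R = "restrict_space borel ?P"
  have F_coord: "(\<lambda>x. partial_deriv i (J i) x) \<in> borel_measurable ?R" for i
  proof -
    have "continuous_on ?P (\<lambda>x. ?F x $ i)" by (intro continuous_intros contF)
    hence "(\<lambda>x. ?F x $ i) \<in> borel_measurable ?R" by (rule borel_measurable_continuous_on_restrict)
    thus ?thesis by (simp add: pseudo_gradient_def)
  qed
  \<comment> \<open>The gradient noise as a function of the past \<open>\<omega>\<close> and of the value \<open>z\<close> of a fresh sample.\<close>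
  define H where "H i k \<omega> z = partial_deriv i (\<lambda>x. f i x z) (X k \<omega>) - partial_deriv i (J i) (X k \<omega>)"
    for i k \<omega> z
  have \<epsilon>_H: "\<epsilon> i k j \<omega> = H i k \<omega> (\<xi> i k j \<omega>)" for i k j \<omega>
    by (simp add: \<epsilon> g H_def)
  have g_meas: "g i k j \<in> borel_measurable N"
    if "X k \<in> measurable N ?R" "\<xi> i k j \<in> borel_measurable N" for i k j and N :: "'w measure"
  proof -
    have "(\<lambda>\<omega>. (X k \<omega>, \<xi> i k j \<omega>)) \<in> measurable N (?R \<Otimes>\<^sub>M borel)" using that by measurable
    from measurable_compose[OF this f_measurable] show ?thesis by (simp add: g[abs_def])
  qed
  have mono\<F>: "measurable (\<F> k) N \<subseteq> measurable (\<F> (Suc k)) N" for k and N :: "(real ^ 'n) measure"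
    using sets_history_mono[of k "Suc k" M "X 0" \<xi> m] by (intro measurable_mono) (auto simp: \<F> history_space_sets(1))
  \<comment> \<open>The gradients are measurable on the set of profiles only; hence the target space.\<close>
  have X_meas: "X k \<in> measurable (\<F> k) ?R" for k
  proof (induction k)
    case 0
    show ?case unfolding \<F>
      using X0(2) by (intro measurable_restrict_space2 measurable_history_initial) (auto simp: history_space_sets(1))
  next
    case (Suc k)
    hence Xk[measurable]: "X k \<in> measurable (\<F> (Suc k)) ?R" using mono\<F> by blast
    have "(\<lambda>\<omega>. X k \<omega> $ i) \<in> borel_measurable (\<F> (Suc k))" for i
    proof -
      have "X k \<in> borel_measurable (\<F> (Suc k))" using Xk by (simp add: measurable_restrict_space2_iff)
      moreover have "(\<lambda>x :: real ^ 'n. x $ i) \<in> borel_measurable borel"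
        by (intro borel_measurable_continuous_onI continuous_intros)
      ultimately show ?thesis by (rule measurable_compose)
    qed
    note [measurable] = this
    have "(\<lambda>\<omega>. corrected_estimate (\<eta> k) (nb k) (s k) (B i k) (\<lambda>j. g i k j \<omega>)) \<in> borel_measurable (\<F> (Suc k))" for i
    proof (rule borel_measurable_corrected_estimate[OF nb1])
      fix l j assume "l \<in> {1..nb k}" "j \<in> B i k l"
      hence "j \<in> {1..m k}" using B(1) by blast
      thus "g i k j \<in> borel_measurable (\<F> (Suc k))"
        unfolding \<F> using Xk by (intro g_meas measurable_history_sample) (auto simp: \<F>)
    qed
    note [measurable] = this
    have [measurable]: "closest_point (\<Omega> i) \<in> borel_measurable borel" for i
      by (rule borel_measurable_continuous_onI[OF continuous_on_closest_point[OF co(2,3,1)]])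
    have "(\<lambda>\<omega>. closest_point (\<Omega> i)
            (X k \<omega> $ i - \<alpha> k * corrected_estimate (\<eta> k) (nb k) (s k) (B i k) (\<lambda>j. g i k j \<omega>)))
          \<in> borel_measurable (\<F> (Suc k))" for i
      by measurable
    hence "(\<lambda>\<omega>. X (Suc k) \<omega> $ i) \<in> borel_measurable (\<F> (Suc k))" for i
      by (subst measurable_cong[OF step]) (simp_all add: spF)
    hence "X (Suc k) \<in> borel_measurable (\<F> (Suc k))"
      by (subst borel_measurable_euclidean_space) (auto simp: Basis_vec_def inner_axis)
    thus ?case using X_in by (intro measurable_restrict_space2) (auto simp: spF)
  qed
  have H_meas: "(\<lambda>(\<omega>, z). H i k \<omega> z) \<in> borel_measurable (\<F> k \<Otimes>\<^sub>M borel)" for i k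
  proof -
    have Xk[measurable]: "X k \<in> measurable (\<F> k) ?R" by (rule X_meas)
    have "(\<lambda>p. (X k (fst p), snd p)) \<in> measurable (\<F> k \<Otimes>\<^sub>M borel) (?R \<Otimes>\<^sub>M borel)" by measurable
    from measurable_compose[OF this f_measurable[of i]]
    have [measurable]: "(\<lambda>p. partial_deriv i (\<lambda>x. f i x (snd p)) (X k (fst p))) \<in> borel_measurable (\<F> k \<Otimes>\<^sub>M borel)"
      by simp
    have [measurable]: "(\<lambda>p. partial_deriv i (J i) (X k (fst p))) \<in> borel_measurable (\<F> k \<Otimes>\<^sub>M borel)"
      by (rule measurable_compose[OF _ F_coord]) measurable
    show ?thesis unfolding H_def case_prod_beta by measurable
  qed

  define err where "err i k l \<omega> = block_mean (s k) (B i k) (\<lambda>j. g i k j \<omega>) l - partial_deriv i (J i) (X k \<omega>)"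
    for i k l \<omega>
  have err_eq: "err i k l \<omega> = (\<Sum>j\<in>B i k l. H i k \<omega> (\<xi> i k j \<omega>)) / real (s k)" if "l \<in> {1..nb k}" for i k l \<omega>
  proof -
    have "card (B i k l) = s k" "s k \<noteq> 0" using B(1)[OF that] s1[of k] by auto
    thus ?thesis by (simp add: err_def block_mean_def H_def g sum_subtractf diff_divide_distrib)
  qed
  have sum_meas: "(\<lambda>\<omega>. \<Sum>j\<in>B i k l. H i k \<omega> (\<xi> i k j \<omega>)) \<in> borel_measurable M" if "l \<in> {1..nb k}" for i k l
  proof (rule borel_measurable_sum)
    fix j assume "j \<in> B i k l"
    hence j: "j \<in> {1..m k}" using B(1)[OF that] by blast
    have "(\<lambda>\<omega>. \<omega>) \<in> measurable M (\<F> k)" by (rule measurable_from_subalg[OF sub[of k]]) simp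
    hence "(\<lambda>\<omega>. (\<omega>, \<xi> i k j \<omega>)) \<in> measurable M (\<F> k \<Otimes>\<^sub>M borel)" using \<xi>_meas[OF j] by measurable
    from measurable_compose[OF this H_meas] show "(\<lambda>\<omega>. H i k \<omega> (\<xi> i k j \<omega>)) \<in> borel_measurable M" by simp
  qed
  \<comment> \<open>A substitute for the largest block error that is additive over the blocks:
    \<open>W powr (1 / \<delta>)\<close> bounds every block error, and the
    expectation of \<open>W\<close> is at most the number of blocks times the bound for a single block. In \<open>q\<close>, the constant 6
    combines the 3 of the moment inequality with the 2 of the bound on the block parameters.\<close>
  define W where "W i k \<omega> = (\<Sum>l=1..nb k. \<bar>(\<Sum>j\<in>B i k l. H i k \<omega> (\<xi> i k j \<omega>)) / real (s k)\<bar> powr \<delta>)" for i k \<omega>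
  define q where "q k = 6 * \<nu> powr \<delta> * ((1 + 16 * ln (real (k + 1)))\<^sup>2 * real (k + 1) powr (- (\<beta> * (\<delta> - 1))))" for k
  have "1 < \<beta> * (\<delta> - 1)" using \<beta> \<delta> by (simp add: field_simps)
  hence q_sum: "summable q" unfolding q_def by (intro summable_mult summable_log_powr)
  have W_bound: "(\<integral>\<^sup>+\<omega>. ennreal (W i k \<omega>) \<partial>M) \<le> ennreal (q k)" for i k
  proof -
    have one: "(\<integral>\<^sup>+\<omega>. ennreal (\<bar>(\<Sum>j\<in>B i k l. H i k \<omega> (\<xi> i k j \<omega>)) / real (s k)\<bar> powr \<delta>) \<partial>M)
        \<le> ennreal (3 * \<nu> powr \<delta> * real (s k) powr (1 - \<delta>))" if l: "l \<in> {1..nb k}" for l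
    proof -
      let ?S = "\<lambda>\<omega>. \<Sum>j\<in>B i k l. H i k \<omega> (\<xi> i k j \<omega>)"
      have "(\<integral>\<^sup>+\<omega>. ennreal (\<bar>?S \<omega>\<bar> powr \<delta>) \<partial>M) \<le> ennreal (3 * card (B i k l) * \<nu> powr \<delta>)"
      proof (rule conditional_sum_powr_moment[where F = "\<F> k" and I = "{1..m k}" and H = "H i k" and \<xi> = "\<xi> i k"])
        show "AE \<omega> in M. real_cond_exp M (\<F> k) (\<lambda>\<omega>. H i k \<omega> (\<xi> i k j \<omega>)) \<omega> = 0" if "j \<in> {1..m k}" for j
          using unbiased[OF that, of i] by (simp add: \<epsilon>_H[abs_def])
        show "AE \<omega> in M. nn_cond_exp M (\<F> k) (\<lambda>\<omega>. ennreal (\<bar>H i k \<omega> (\<xi> i k j \<omega>)\<bar> powr \<delta>)) \<omega> \<le> ennreal (\<nu> powr \<delta>)"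
          if "j \<in> {1..m k}" for j
          using moment[OF that, of i] by (simp add: \<epsilon>_H)
      qed (use \<delta> \<nu> sub samples_indep samples_fresh H_meas B(1)[OF l] in auto)
      hence S: "(\<integral>\<^sup>+\<omega>. ennreal (\<bar>?S \<omega>\<bar> powr \<delta>) \<partial>M) \<le> ennreal (3 * real (s k) * \<nu> powr \<delta>)"
        using B(1)[OF l] by simp
      have [measurable]: "?S \<in> borel_measurable M" by (rule sum_meas[OF l])
      have "\<bar>?S \<omega> / real (s k)\<bar> powr \<delta> = real (s k) powr (- \<delta>) * \<bar>?S \<omega>\<bar> powr \<delta>" for \<omega>
        by (simp add: powr_divide powr_minus divide_inverse mult.commute abs_mult powr_mult inverse_powr)
      hence "(\<integral>\<^sup>+\<omega>. ennreal (\<bar>?S \<omega> / real (s k)\<bar> powr \<delta>) \<partial>M)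
          = ennreal (real (s k) powr (- \<delta>)) * (\<integral>\<^sup>+\<omega>. ennreal (\<bar>?S \<omega>\<bar> powr \<delta>) \<partial>M)"
        by (simp add: ennreal_mult nn_integral_cmult)
      also have "\<dots> \<le> ennreal (real (s k) powr (- \<delta>)) * ennreal (3 * real (s k) * \<nu> powr \<delta>)"
        by (rule mult_left_mono[OF S]) simp
      also have "\<dots> = ennreal (3 * \<nu> powr \<delta> * (real (s k) * real (s k) powr (- \<delta>)))"
        by (simp add: ennreal_mult[symmetric] mult_ac)
      also have "real (s k) * real (s k) powr (- \<delta>) = real (s k) powr (1 - \<delta>)"
        using powr_mult_base[of "real (s k)" "- \<delta>"] by simp
      finally show ?thesis .
    qed
    have "(\<integral>\<^sup>+\<omega>. ennreal (W i k \<omega>) \<partial>M)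
        = (\<integral>\<^sup>+\<omega>. (\<Sum>l=1..nb k. ennreal (\<bar>(\<Sum>j\<in>B i k l. H i k \<omega> (\<xi> i k j \<omega>)) / real (s k)\<bar> powr \<delta>)) \<partial>M)"
      unfolding W_def by (subst sum_ennreal) auto
    also have "\<dots> = (\<Sum>l=1..nb k. \<integral>\<^sup>+\<omega>. ennreal (\<bar>(\<Sum>j\<in>B i k l. H i k \<omega> (\<xi> i k j \<omega>)) / real (s k)\<bar> powr \<delta>) \<partial>M)"
    proof (rule nn_integral_sum)
      fix l assume "l \<in> {1..nb k}"
      note [measurable] = sum_meas[OF this, of i]
      show "(\<lambda>\<omega>. ennreal (\<bar>(\<Sum>j\<in>B i k l. H i k \<omega> (\<xi> i k j \<omega>)) / real (s k)\<bar> powr \<delta>)) \<in> borel_measurable M"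
        by measurable
    qed
    also have "\<dots> \<le> (\<Sum>l=1..nb k. ennreal (3 * \<nu> powr \<delta> * real (s k) powr (1 - \<delta>)))"
      by (intro sum_mono one)
    also have "\<dots> = ennreal (3 * \<nu> powr \<delta> * (real (nb k) * real (s k) powr (1 - \<delta>)))"
      by (subst sum_ennreal) (auto simp: mult_ac)
    also have "\<dots> \<le> ennreal (q k)"
      using mult_left_mono[OF nb_s[of k], of "3 * \<nu> powr \<delta>"] unfolding q_def
      by (intro ennreal_leI) (simp add: mult_ac)
    finally show ?thesis .
  qed
  have W_meas: "W i k \<in> borel_measurable M" for i k
    unfolding W_def
  proof (rule borel_measurable_sum)
    fix l assume "l \<in> {1..nb k}"
    note [measurable] = sum_meas[OF this, of i]
    show "(\<lambda>\<omega>. \<bar>(\<Sum>j\<in>B i k l. H i k \<omega> (\<xi> i k j \<omega>)) / real (s k)\<bar> powr \<delta>) \<in> borel_measurable M"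
      by measurable
  qed
  have W0: "0 \<le> W i k \<omega>" for i k \<omega> unfolding W_def by (intro sum_nonneg) simp
  have "AE \<omega> in M. (\<lambda>k. W i k \<omega>) \<longlonglongrightarrow> 0" for i
    using W_meas W0 W_bound q_sum
    by (intro AE_tendsto_zero_of_summable_moments[where q = q]) (auto simp: q_def)
  hence "AE \<omega> in M. \<forall>i\<in>UNIV. (\<lambda>k. W i k \<omega>) \<longlonglongrightarrow> 0"
    by (intro AE_finite_allI) auto

  define G where "G k \<omega> = (\<chi> i. corrected_estimate (\<eta> k) (nb k) (s k) (B i k) (\<lambda>j. g i k j \<omega>))" for k \<omega>
  have G_err: "\<bar>(G k \<omega> - ?F (X k \<omega>)) $ i\<bar> \<le> W i k \<omega> powr (1 / \<delta>)" for i k \<omega>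
  proof -
    have "\<bar>corrected_estimate (\<eta> k) (nb k) (s k) (B i k) (\<lambda>j. g i k j \<omega>) - partial_deriv i (J i) (X k \<omega>)\<bar>
        \<le> W i k \<omega> powr (1 / \<delta>)"
    proof (rule corrected_estimate_deviation_le)
      fix l assume l: "l \<in> {1..nb k}"
      have "\<bar>err i k l \<omega>\<bar> powr \<delta> \<le> W i k \<omega>"
        unfolding W_def err_eq[OF l] using l by (intro member_le_sum) auto
      hence "(\<bar>err i k l \<omega>\<bar> powr \<delta>) powr (1 / \<delta>) \<le> W i k \<omega> powr (1 / \<delta>)"
        using \<delta> by (intro powr_mono2) auto
      thus "\<bar>block_mean (s k) (B i k) (\<lambda>j. g i k j \<omega>) l - partial_deriv i (J i) (X k \<omega>)\<bar> \<le> W i k \<omega> powr (1 / \<delta>)"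
        using \<delta> by (simp add: err_def powr_powr)
    qed (use \<eta>_range[of k] nb1 in auto)
    thus ?thesis by (simp add: G_def pseudo_gradient_def)
  qed
  have \<alpha>_pos: "0 < \<alpha> k" for k using b by (simp add: \<alpha>)
  have \<alpha>_lim: "\<alpha> \<longlonglongrightarrow> 0"
  proof -
    have "(\<lambda>k. b * real (k + 1) powr (- a)) \<longlonglongrightarrow> 0" using a(1) by real_asymp
    thus ?thesis by (simp add: \<alpha>[abs_def])
  qed
  have \<alpha>_sum: "\<not> summable \<alpha>"
  proof
    assume "summable \<alpha>"
    hence "summable (\<lambda>k. real (k + 1) powr (- a))"
      using b by (simp add: \<alpha>[abs_def] summable_cmult_iff del: of_nat_Suc of_nat_add)
    hence "summable (\<lambda>k. real k powr (- a))" using summable_iff_shift[of "\<lambda>k. real k powr (- a)" 1] by blast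
    thus False using a(2) by (simp add: summable_real_powr_iff)
  qed
  have "AE \<omega> in M. (\<lambda>k. norm (X k \<omega> - y)) \<longlonglongrightarrow> 0"
    using \<open>AE \<omega> in M. \<forall>i\<in>UNIV. (\<lambda>k. W i k \<omega>) \<longlonglongrightarrow> 0\<close>
  proof (rule AE_mp, intro AE_I2 impI)
    fix \<omega> assume \<omega>: "\<omega> \<in> space M" and lim: "\<forall>i\<in>UNIV. (\<lambda>k. W i k \<omega>) \<longlonglongrightarrow> 0"
    have "(\<lambda>k. G k \<omega> - ?F (X k \<omega>)) \<longlonglongrightarrow> 0"
    proof (rule vec_tendstoI)
      fix i
      have r: "(\<lambda>k. W i k \<omega> powr (1 / \<delta>)) \<longlonglongrightarrow> 0"
        using lim \<delta> W0 by (intro tendsto_zero_powrI[OF _ tendsto_const]) auto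
      have "\<forall>\<^sub>F k in sequentially. norm ((G k \<omega> - ?F (X k \<omega>)) $ i) \<le> W i k \<omega> powr (1 / \<delta>)"
        by (intro always_eventually allI) (simp only: real_norm_def G_err)
      from Lim_null_comparison[OF this r]
      show "(\<lambda>k. (G k \<omega> - ?F (X k \<omega>)) $ i) \<longlonglongrightarrow> 0 $ i" by simp
    qed
    thus "(\<lambda>k. norm (X k \<omega> - y)) \<longlonglongrightarrow> 0"
      using step[OF \<omega>] X_in[OF \<omega>]
      by (intro inexact_projected_gradient_tendsto[OF \<Omega> \<mu> strongly_monotone lipschitz \<alpha>_pos \<alpha>_lim \<alpha>_sum _ _ _ y])
         (auto simp: G_def)
  qed
  thus ?thesis using unique by blast
qed

end
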